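(* Let $\mathcal{P}$ be a finite-dimensional Poisson algebra over a field $\mathbb{F}$, with radical $R$ and nilradical $N$. Then $\mathcal{P}$ is $\phi$-free if and only if $\mathcal{P}=N\dot{+}U$ for some subalgebra $U$ of $\mathcal{P}$, $N=Zsoc(\mathcal{P})$, and $R_A^2=R\cdot R=0$. If moreover $\mathbb{F}$ has characteristic zero, then in such a decomposition (of a $\phi$-free $\mathcal{P}$) one has $(U\cap R)^2=0$, i.e. $(U\cap R)\cdot(U\cap R)+[U\cap R,U\cap R]=0$.
   Context: A Poisson algebra $(\mathcal{P},\cdot,[\cdot,\cdot])$ over $\mathbb{F}$ is a vector space with two bilinear products such that $(\mathcal{P},\cdot)$ is a commutative associative algebra (not necessarily unital), $(\mathcal{P},[\cdot,\cdot])$ is a Lie algebra, and $[x\cdot y,z]=[x,z]\cdot y+x\cdot[y,z]$ for all $x,y,z$. Products of subspaces are linear spans. A subalgebra is a subspace closed under both products; an ideal is a subspace $I$ with $I\cdot\mathcal{P}+[I,\mathcal{P}]\subseteq I$; a zero ideal is an ideal $I$ with $I\cdot I+[I,I]=0$. The zero socle $Zsoc(\mathcal{P})$ is the sum of those minimal (nonzero) ideals of $\mathcal{P}$ that are zero ideals. A Poisson algebra $A$ is solvable if $A^{(m)}=0$ for some $m$, where $A^{(0)}=A$ and $A^{(n+1)}=A^{(n)}\cdot A^{(n)}+[A^{(n)},A^{(n)}]$; it is nilpotent if $A^m=0$ for some $m$, where $A^1=A$ and $A^{n+1}=\sum_{i=1}^{n}(A^i\cdot A^{n+1-i}+[A^i,A^{n+1-i}])$.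 The radical is the largest solvable ideal of $\mathcal{P}$ and the nilradical is the largest nilpotent ideal of $\mathcal{P}$. The Frattini subalgebra $F(\mathcal{P})$ is the intersection of the maximal (proper) subalgebras of $\mathcal{P}$, the Frattini ideal $\phi(\mathcal{P})$ is the largest ideal of $\mathcal{P}$ contained in $F(\mathcal{P})$, and $\mathcal{P}$ is $\phi$-free if $\phi(\mathcal{P})=0$. The symbol $\dot{+}$ denotes a direct sum of underlying vector spaces. *)

theory Defs
  imports Complex_Main "HOL-Library.Set_Algebras"
begin

text \<open>
  The Poisson algebra is the whole type \<^typ>\<open>'p\<close>, with scalars acting through an explicit
  function, so that \<^const>\<open>UNIV\<close> plays the role of the algebra itself. Subspaces are sets, and
  sums of subspaces, binary or finite, are those of \<^theory>\<open>HOL-Library.Set_Algebras\<close>.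
\<close>

definition direct_decomposition :: "'p::ab_group_add set \<Rightarrow> 'p set \<Rightarrow> bool" where
  "direct_decomposition S T \<longleftrightarrow> S + T = UNIV \<and> S \<inter> T = {0}"

locale poisson_algebra = vector_space scale
  for scale :: "'k::field \<Rightarrow> 'p::ab_group_add \<Rightarrow> 'p" +
  fixes mult :: "'p \<Rightarrow> 'p \<Rightarrow> 'p"  (infixl \<open>\<cdot>\<close> 70)
    and brk :: "'p \<Rightarrow> 'p \<Rightarrow> 'p"  (\<open>\<lbrace>_, _\<rbrace>\<close>)
  assumes mult_linear_right: "\<And>x. Vector_Spaces.linear scale scale (\<lambda>y. x \<cdot> y)"
    and mult_linear_left: "\<And>y. Vector_Spaces.linear scale scale (\<lambda>x. x \<cdot> y)"
    and brk_linear_right: "\<And>x. Vector_Spaces.linear scale scale (\<lambda>y. \<lbrace>x, y\<rbrace>)"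
    and brk_linear_left: "\<And>y. Vector_Spaces.linear scale scale (\<lambda>x. \<lbrace>x, y\<rbrace>)"
    and mult_assoc: "\<And>x y z. (x \<cdot> y) \<cdot> z = x \<cdot> (y \<cdot> z)"
    and mult_commute: "\<And>x y. x \<cdot> y = y \<cdot> x"
    and brk_alternating: "\<And>x. \<lbrace>x, x\<rbrace> = 0"
    and jacobi: "\<And>x y z. \<lbrace>x, \<lbrace>y, z\<rbrace>\<rbrace> + \<lbrace>y, \<lbrace>z, x\<rbrace>\<rbrace> + \<lbrace>z, \<lbrace>x, y\<rbrace>\<rbrace> = 0"
    and leibniz: "\<And>x y z. \<lbrace>x \<cdot> y, z\<rbrace> = \<lbrace>x, z\<rbrace> \<cdot> y + x \<cdot> \<lbrace>y, z\<rbrace>"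
begin

definition mult_space :: "'p set \<Rightarrow> 'p set \<Rightarrow> 'p set" where
  "mult_space S T = span {x \<cdot> y | x y. x \<in> S \<and> y \<in> T}"

definition brk_space :: "'p set \<Rightarrow> 'p set \<Rightarrow> 'p set" where
  "brk_space S T = span {\<lbrace>x, y\<rbrace> | x y. x \<in> S \<and> y \<in> T}"

definition square :: "'p set \<Rightarrow> 'p set" where
  "square S = mult_space S S + brk_space S S"

definition subalgebra :: "'p set \<Rightarrow> bool" where
  "subalgebra S \<longleftrightarrow> subspace S \<and> (\<forall>x\<in>S. \<forall>y\<in>S. x \<cdot> y \<in> S \<and> \<lbrace>x, y\<rbrace> \<in> S)"

definition ideal :: "'p set \<Rightarrow> bool" where
  "ideal I \<longleftrightarrow> subspace I \<and> mult_space I UNIV + brk_space I UNIV \<subseteq> I"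

definition zero_ideal :: "'p set \<Rightarrow> bool" where
  "zero_ideal I \<longleftrightarrow> ideal I \<and> square I = {0}"

definition minimal_ideal :: "'p set \<Rightarrow> bool" where
  "minimal_ideal I \<longleftrightarrow>
     ideal I \<and> I \<noteq> {0} \<and> (\<forall>J. ideal J \<and> J \<subseteq> I \<longrightarrow> J = {0} \<or> J = I)"

definition zsoc :: "'p set" where
  "zsoc = span (\<Union>{I. minimal_ideal I \<and> zero_ideal I})"

primrec derived :: "'p set \<Rightarrow> nat \<Rightarrow> 'p set" where
  "derived A 0 = A"
| "derived A (Suc n) = square (derived A n)"

definition solvable :: "'p set \<Rightarrow> bool" where
  "solvable A \<longleftrightarrow> (\<exists>m. derived A m = {0})"

text \<open>
  The powers start with exponent 1; exponent 0 carries no meaning. The lemmas below give the usual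
  form of the recursion.
\<close>

fun alg_power :: "'p set \<Rightarrow> nat \<Rightarrow> 'p set" where
  "alg_power A n =
     (if n \<le> 1 then A
      else (\<Sum>i\<in>{1..<n}. mult_space (alg_power A i) (alg_power A (n - i)) +
                         brk_space (alg_power A i) (alg_power A (n - i))))"

declare alg_power.simps [simp del]

lemma alg_power_1: "alg_power A 1 = A"
  by (simp add: alg_power.simps)

lemma alg_power_Suc:
  assumes "n \<ge> 1"
  shows "alg_power A (n + 1) =
    (\<Sum>i=1..n. mult_space (alg_power A i) (alg_power A (n + 1 - i)) +
               brk_space (alg_power A i) (alg_power A (n + 1 - i)))"
  using assms by (subst alg_power.simps) (simp add: atLeastLessThanSuc_atLeastAtMost)

definition nilpotent :: "'p set \<Rightarrow> bool" where
  "nilpotent A \<longleftrightarrow> (\<exists>m\<ge>1. alg_power A m = {0})"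

definition radical :: "'p set" where
  "radical = (GREATEST I. ideal I \<and> solvable I)"

definition nilradical :: "'p set" where
  "nilradical = (GREATEST I. ideal I \<and> nilpotent I)"

definition maximal_subalgebra :: "'p set \<Rightarrow> bool" where
  "maximal_subalgebra M \<longleftrightarrow>
     subalgebra M \<and> M \<noteq> UNIV \<and> (\<forall>S. subalgebra S \<and> M \<subseteq> S \<longrightarrow> S = M \<or> S = UNIV)"

text \<open>
  If there are no maximal subalgebras (for finite-dimensional algebras: only for the zero algebra),
  the empty intersection is the whole algebra.
\<close>

definition frattini_subalgebra :: "'p set" where
  "frattini_subalgebra = \<Inter>{M. maximal_subalgebra M}"

definition frattini_ideal :: "'p set" where
  "frattini_ideal = (GREATEST I. ideal I \<and> I \<subseteq> frattini_subalgebra)"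

definition phi_free :: bool where
  "phi_free \<longleftrightarrow> frattini_ideal = {0}"

end

end

theory Submission
  imports Defs "HOL-Computational_Algebra.Polynomial"
begin

text \<open>
  Call a proper subalgebra \<open>M\<close> with \<open>J + M = P\<close> a supplement of the ideal \<open>J\<close>. The algebra \<open>P\<close> is
  \<open>\<phi>\<close>-free if and only if every nonzero ideal has a supplement
  (\<open>phi_free_iff_supplemented\<close>), and both directions are proved in this form.

  Let \<open>P\<close> be \<open>\<phi>\<close>-free. A nilpotent algebra is generated by any subalgebra that covers it modulo
  products. Since \<open>N\<close> is nilpotent, and \<open>R\<close> is nilpotent with respect to the associative product
  alone, every subalgebra \<open>M\<close> with \<open>N\<^sup>2 + M = P\<close> or \<open>R \<cdot> R + M = P\<close> is therefore all of \<open>P\<close>. So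
  neither \<open>N\<^sup>2\<close> nor \<open>R \<cdot> R\<close> has a supplement, and both vanish
  (\<open>phi_free_product_ideal_trivial\<close>). A zero ideal \<open>I\<close> has a complement, namely any subalgebra
  \<open>U\<close> that is minimal subject to \<open>I + U = P\<close> (\<open>phi_free_zero_ideal_complement\<close>). This applies to
  \<open>N\<close>, and also to the ideals inside \<open>N\<close>, which makes \<open>N\<close> completely reducible and thus equal to
  the zero socle.

  Conversely let \<open>P\<close> be the direct sum of its zero socle and a subalgebra \<open>U\<close>. It is enough to
  supplement the minimal ideals \<open>I\<close>. If \<open>I\<close> is a zero ideal, then \<open>I\<close> has an ideal complement \<open>C\<close>
  in the zero socle, and \<open>C + U\<close> is a supplement. If not, then by Engel's theorem some \<open>x \<in> I\<close>
  acts on \<open>P\<close> non-nilpotently, either by multiplication or by the bracket. The Fitting null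
  component of that operator is a proper subalgebra, and it supplements \<open>I\<close> because the range of
  the operator lies in \<open>I\<close> (\<open>minimal_nonzero_product_ideal_supplement\<close>).

  In characteristic zero, a commutator \<open>[l, f]\<close> of operators that commutes with \<open>f\<close> is nilpotent
  (\<open>commutator_nilpotent\<close>). This takes the place of Lie's theorem and shows that suitable
  commutators of elements of \<open>U \<inter> R\<close> act nilpotently on \<open>P\<close>. As an abelian ideal of \<open>U\<close> inside
  \<open>R\<close> that acts nilpotently lies in \<open>N \<inter> U = 0\<close> (\<open>phi_free_nil_ideal_trivial\<close>), the last nonzero
  term of the derived series of \<open>U \<inter> R\<close> cannot be the square of an earlier one
  (\<open>square_trivial_if_square_abelian\<close>), and hence \<open>U \<inter> R\<close> has zero products.
\<close>

section \<open>Linear operators on a finite-dimensional space\<close>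

context finite_dimensional_vector_space
begin

abbreviation lin :: "('b \<Rightarrow> 'b) \<Rightarrow> bool" where
  "lin \<equiv> Vector_Spaces.linear scale scale"

lemma lin_simps:
  assumes "lin f"
  shows "f (x + y) = f x + f y" "f (x - y) = f x - f y" "f (- x) = - f x"
    "f (scale c x) = scale c (f x)" "f 0 = 0"
proof -
  interpret Vector_Spaces.linear scale scale f by fact
  show "f (x + y) = f x + f y" "f (x - y) = f x - f y" "f (- x) = - f x"
    "f (scale c x) = scale c (f x)" "f 0 = 0"
    by (simp_all add: add diff neg scale)
qed

lemma subspace_preimage:
  assumes "lin f" "subspace W"
  shows "subspace {v. f v \<in> W}"
proof -
  interpret Vector_Spaces.linear scale scale f by fact
  show ?thesis using assms(2) by (rule subspace_linear_preimage)
qed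

lemma lin_funpow: "lin f \<Longrightarrow> lin (f ^^ n)"
  by (induction n) (auto simp: Vector_Spaces.linear_iff)

lemma funpow_zero: "lin f \<Longrightarrow> (f ^^ n) 0 = 0"
  by (rule lin_simps(5)[OF lin_funpow])

lemma funpow_zero_mono: "lin f \<Longrightarrow> (f ^^ m) v = 0 \<Longrightarrow> m \<le> n \<Longrightarrow> (f ^^ n) v = 0"
  using funpow_zero[of f "n - m"] funpow_add[of "n - m" m f] by simp

lemma subspace_plus: "subspace S \<Longrightarrow> subspace T \<Longrightarrow> subspace (S + T)"
proof -
  assume "subspace S" "subspace T"
  moreover have "S + T = {x + y |x y. x \<in> S \<and> y \<in> T}" unfolding set_plus_def by blast
  ultimately show ?thesis using subspace_sums[of S T] by simp
qed

lemma plus_subset_iff: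
  assumes "subspace S" "subspace T" "subspace W"
  shows "S + T \<subseteq> W \<longleftrightarrow> S \<subseteq> W \<and> T \<subseteq> W"
proof
  assume *: "S + T \<subseteq> W"
  have "S \<subseteq> S + T" using set_zero_plus2[OF subspace_0[OF assms(2)], of S] by (simp add: add.commute)
  moreover have "T \<subseteq> S + T" using set_zero_plus2[OF subspace_0[OF assms(1)]] .
  ultimately show "S \<subseteq> W \<and> T \<subseteq> W" using * by blast
next
  assume "S \<subseteq> W \<and> T \<subseteq> W"
  then show "S + T \<subseteq> W" using subspace_add[OF assms(3)] by (auto elim!: set_plus_elim)
qed

lemma plus_upper:
  assumes "subspace S" "subspace T"
  shows "S \<subseteq> S + T" "T \<subseteq> S + T"
  using plus_subset_iff[OF assms subspace_plus[OF assms]] by auto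

lemma maximal_subspace_exists:
  assumes "P S" and sub: "\<And>T. P T \<Longrightarrow> subspace T"
  obtains M where "P M" "S \<subseteq> M" "\<And>T. P T \<Longrightarrow> M \<subseteq> T \<Longrightarrow> T = M"
proof -
  obtain M where M: "P M \<and> S \<subseteq> M" and max: "\<And>T. P T \<and> S \<subseteq> T \<Longrightarrow> dim T \<le> dim M"
    using ex_has_greatest_nat[of "\<lambda>T. P T \<and> S \<subseteq> T" S dim "Suc dimension"] assms(1) dim_subset_UNIV le_imp_less_Suc
    by auto
  show ?thesis
  proof (rule that[of M])
    show "T = M" if "P T" "M \<subseteq> T" for T
    proof (rule subspace_dim_equal[symmetric])
      have "S \<subseteq> T" using that M by (meson subset_trans)
      then show "dim T \<le> dim M" using that max by simp
      show "subspace M" "subspace T" "M \<subseteq> T" using that M sub by simp_all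
    qed
  qed (use M in auto)
qed

lemma minimal_subspace_exists:
  assumes "P S" and sub: "\<And>T. P T \<Longrightarrow> subspace T"
  obtains M where "P M" "M \<subseteq> S" "\<And>T. P T \<Longrightarrow> T \<subseteq> M \<Longrightarrow> T = M"
proof -
  obtain M where M: "P M \<and> M \<subseteq> S" and min: "\<And>T. P T \<and> T \<subseteq> S \<Longrightarrow> dim M \<le> dim T"
    using ex_has_least_nat[of "\<lambda>T. P T \<and> T \<subseteq> S" S dim] assms(1) by auto
  show ?thesis
  proof (rule that[of M])
    show "T = M" if "P T" "T \<subseteq> M" for T
    proof (rule subspace_dim_equal)
      have "T \<subseteq> S" using that M by (meson subset_trans)
      then show "dim M \<le> dim T" using that min by simp
      show "subspace T" "subspace M" "T \<subseteq> M" using that M sub by simp_all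
    qed
  qed (use M in auto)
qed

text \<open>A property of subspaces that survives sums has a greatest instance, because an instance of
  maximal dimension already absorbs every other one.\<close>

lemma greatest_subspace_exists:
  assumes "P {0}" and sub: "\<And>T. P T \<Longrightarrow> subspace T"
    and plus: "\<And>S T. P S \<Longrightarrow> P T \<Longrightarrow> P (S + T)"
  shows "P (GREATEST S. P S)" "P T \<Longrightarrow> T \<subseteq> (GREATEST S. P S)"
proof -
  obtain M where M: "P M" "\<And>T. P T \<Longrightarrow> M \<subseteq> T \<Longrightarrow> T = M"
    using maximal_subspace_exists[of P, OF assms(1) sub] by metis
  have *: "T \<subseteq> M" if "P T" for T
    using M(2)[OF plus[OF M(1) that] plus_upper(1)] plus_upper(2)[OF sub sub, OF M(1) that]
      sub[OF M(1)] sub[OF that] by simp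
  have "(GREATEST S. P S) = M" using M(1) * by (rule Greatest_equality)
  then show "P (GREATEST S. P S)" "P T \<Longrightarrow> T \<subseteq> (GREATEST S. P S)" using M(1) *[of T] by simp_all
qed

section \<open>The Fitting null component\<close>

definition null_component :: "('b \<Rightarrow> 'b) \<Rightarrow> 'b set" where
  "null_component f = {v. \<exists>n. (f ^^ n) v = 0}"

lemma subspace_null_component:
  assumes "lin f"
  shows "subspace (null_component f)"
proof (rule subspaceI)
  show "0 \<in> null_component f" by (auto simp: null_component_def intro: exI[of _ 0])
  fix x y c assume "x \<in> null_component f" "y \<in> null_component f"
  then obtain m n where "(f ^^ m) x = 0" "(f ^^ n) y = 0" by (auto simp: null_component_def)
  then have "(f ^^ (m + n)) x = 0" "(f ^^ (m + n)) y = 0"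
    using funpow_zero_mono[OF assms] by simp_all
  then show "x + y \<in> null_component f" "scale c x \<in> null_component f"
    using lin_simps[OF lin_funpow[OF assms]] unfolding null_component_def
    by (auto intro!: exI[of _ "m + n"])
qed

text \<open>Fitting's lemma. The ranges of the powers of \<open>f\<close> stop shrinking, so that
  \<open>f\<^sup>n\<close> and \<open>f\<^sup>2\<^sup>n\<close> have the same range for some \<open>n\<close>; then \<open>f\<^sup>n v = f\<^sup>2\<^sup>n w\<close> for
  some \<open>w\<close>.\<close>

lemma fitting:
  assumes "lin f"
  obtains n w where "n \<ge> 1" "v - (f ^^ n) w \<in> null_component f"
proof -
  obtain n where n: "n \<ge> 1" and min: "\<And>m. m \<ge> 1 \<Longrightarrow> dim (range (f ^^ n)) \<le> dim (range (f ^^ m))"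
    using ex_has_least_nat[of "\<lambda>n. n \<ge> 1" 1 "\<lambda>n. dim (range (f ^^ n))"] by auto
  have sub: "subspace (range (f ^^ m))" for m
  proof -
    interpret Vector_Spaces.linear scale scale "f ^^ m" by (rule lin_funpow[OF assms])
    show ?thesis by (rule subspace_image) simp
  qed
  have "range (f ^^ (n + n)) = range (f ^^ n)"
    using n by (intro subspace_dim_equal sub min) (auto simp: funpow_add)
  then obtain w where "(f ^^ n) v = (f ^^ n) ((f ^^ n) w)"
    by (metis comp_apply funpow_add imageE rangeI)
  then have "(f ^^ n) (v - (f ^^ n) w) = 0"
    by (simp add: lin_simps[OF lin_funpow[OF assms]])
  then show ?thesis using that n by (auto simp: null_component_def)
qed

text \<open>The null component of a derivation is closed under the product: in the Leibniz expansion
  of a high power, every term hits one of the two factors often enough.\<close>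

lemma null_component_derivation:
  assumes D: "lin D" and leib: "\<And>x y. D (b x y) = b (D x) y + b x (D y)"
    and zero: "\<And>x. b 0 x = 0" "\<And>x. b x 0 = 0"
    and xy: "x \<in> null_component D" "y \<in> null_component D"
  shows "b x y \<in> null_component D"
proof -
  have *: "(D ^^ k) (b x y) = 0" if "(D ^^ m) x = 0" "(D ^^ n) y = 0" "k = m + n" for k m n x y
    using that
  proof (induction k arbitrary: m n x y)
    case 0
    then show ?case by (simp add: zero)
  next
    case (Suc k)
    show ?case
    proof (cases "m = 0 \<or> n = 0")
      case True
      then have "b x y = 0" using Suc.prems zero by auto
      then show ?thesis by (simp only: funpow_zero[OF D])
    next
      case False
      then obtain m' n' where [simp]: "m = Suc m'" "n = Suc n'" by (metis not0_implies_Suc)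
      have "(D ^^ k) (b (D x) y) = 0"
        by (rule Suc.IH[of m' _ n]) (use Suc.prems in \<open>simp_all add: funpow_swap1\<close>)
      moreover have "(D ^^ k) (b x (D y)) = 0"
        by (rule Suc.IH[of m _ n']) (use Suc.prems in \<open>simp_all add: funpow_swap1\<close>)
      ultimately show ?thesis
        by (simp add: funpow_Suc_right leib lin_simps[OF lin_funpow[OF D]] del: funpow.simps)
    qed
  qed
  show ?thesis using xy * unfolding null_component_def by blast
qed

lemma null_component_add_commuting:
  assumes "lin f" "lin g" and comm: "\<And>v. f (g v) = g (f v)"
    and v: "v \<in> null_component f" "v \<in> null_component g"
  shows "v \<in> null_component (\<lambda>v. f v + g v)"
proof -
  have lin: "lin (\<lambda>v. f v + g v)"
    using assms(1,2) by (auto simp: Vector_Spaces.linear_iff scale_right_distrib)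
  have fg: "f ((g ^^ n) v) = (g ^^ n) (f v)" for n v
    by (induction n) (simp_all add: comm)
  have gf: "g ((f ^^ n) v) = (f ^^ n) (g v)" for n v
    by (induction n) (simp_all add: comm[symmetric])
  have "((\<lambda>v. f v + g v) ^^ k) v = 0" if "(f ^^ m) v = 0" "(g ^^ n) v = 0" "k = m + n" for k m n v
    using that
  proof (induction k arbitrary: m n v)
    case 0
    then show ?case by simp
  next
    case (Suc k)
    show ?case
    proof (cases "m = 0 \<or> n = 0")
      case True
      then have "v = 0" using Suc.prems by auto
      then show ?thesis by (simp only: funpow_zero[OF lin])
    next
      case False
      then obtain m' n' where [simp]: "m = Suc m'" "n = Suc n'" by (metis not0_implies_Suc)
      have "(g ^^ n) (f v) = 0" "(f ^^ m) (g v) = 0"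
        using Suc.prems fg[of n v] gf[of m v] lin_simps(5)[OF assms(1)] lin_simps(5)[OF assms(2)]
        by simp_all
      have "((\<lambda>v. f v + g v) ^^ k) (f v) = 0"
        by (rule Suc.IH[of m' _ n])
           (use Suc.prems \<open>(g ^^ n) (f v) = 0\<close> in \<open>simp_all add: funpow_swap1\<close>)
      moreover have "((\<lambda>v. f v + g v) ^^ k) (g v) = 0"
        by (rule Suc.IH[of m _ n'])
           (use Suc.prems \<open>(f ^^ m) (g v) = 0\<close> in \<open>simp_all add: funpow_swap1\<close>)
      ultimately show ?thesis
        by (simp add: funpow_Suc_right lin_simps[OF lin_funpow[OF lin]] del: funpow.simps)
    qed
  qed
  then show ?thesis using v unfolding null_component_def by blast
qed

section \<open>Engel's theorem\<close>

text \<open>\<open>L\<close> acts through \<open>op\<close> on the quotient \<open>V / W\<close>, as a Lie algebra with bracket \<open>br\<close>, by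
  nilpotent operators. Working with a pair \<open>W \<subseteq> V\<close> inside one space replaces quotient spaces in
  the induction that proves Engel's theorem.\<close>

definition nil_action ::
    "('b \<Rightarrow> 'b \<Rightarrow> 'b) \<Rightarrow> 'b set \<Rightarrow> 'b set \<Rightarrow> 'b set \<Rightarrow> ('b \<Rightarrow> 'b \<Rightarrow> 'b) \<Rightarrow> bool" where
  "nil_action br L V W op \<longleftrightarrow>
     subspace V \<and> subspace W \<and> W \<subseteq> V \<and>
     (\<forall>x. lin (op x)) \<and> (\<forall>v. lin (\<lambda>x. op x v)) \<and>
     (\<forall>x\<in>L. \<forall>v\<in>V. op x v \<in> V) \<and> (\<forall>x\<in>L. \<forall>w\<in>W. op x w \<in> W) \<and>
     (\<forall>x\<in>L. \<forall>y\<in>L. \<forall>v\<in>V. op x (op y v) = op (br x y) v + op y (op x v)) \<and>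
     (\<forall>x\<in>L. \<forall>v\<in>V. \<exists>n. (op x ^^ n) v \<in> W)"

lemma nil_action_mono:
  assumes "nil_action br L V W op" "K \<subseteq> L"
  shows "nil_action br K V W op"
proof -
  have *: "\<forall>x\<in>K. P x" if "\<forall>x\<in>L. P x" for P using that assms(2) by blast
  have "\<forall>x\<in>K. \<forall>y\<in>K. \<forall>v\<in>V. op x (op y v) = op (br x y) v + op y (op x v)"
    using assms unfolding nil_action_def by (intro * ballI) blast
  then show ?thesis
    using assms(1) unfolding nil_action_def by (intro conjI) (blast intro!: * dest: *)+
qed

text \<open>Induction on the dimension of \<open>L\<close>. A maximal proper subalgebra \<open>K\<close> of \<open>L\<close> acts nilpotently
  on \<open>L / K\<close>, and so the induction hypothesis yields \<open>y\<close> outside \<open>K\<close> that normalises \<open>K\<close>. By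
  maximality \<open>L\<close> is spanned by \<open>K\<close> and \<open>y\<close>. The vectors of \<open>V / W\<close> killed by \<open>K\<close> form a nonzero
  space, by the induction hypothesis again, and \<open>y\<close> maps this space to itself. The last nonzero
  vector that repeated application of \<open>y\<close> produces in it is killed by all of \<open>L\<close>.\<close>

theorem engel:
  assumes alt: "\<And>x. br x x = 0"
    and L: "subspace L" and ad: "nil_action br L L {0} br"
    and act: "nil_action br L V W op" and "V \<noteq> W"
  shows "\<exists>v\<in>V - W. \<forall>x\<in>L. op x v \<in> W"
  using L ad act \<open>V \<noteq> W\<close>
proof (induction "dim L" arbitrary: L V W op rule: less_induct)
  case less
  note L = \<open>subspace L\<close> and ad = \<open>nil_action br L L {0} br\<close> and act = \<open>nil_action br L V W op\<close>
  have V: "subspace V" and W: "subspace W" "W \<subseteq> V"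
    and op: "\<And>x. lin (op x)" "\<And>v. lin (\<lambda>x. op x v)"
    using act unfolding nil_action_def by blast+
  have br: "\<And>x. lin (br x)" "\<And>v. lin (\<lambda>x. br x v)" "\<And>x y. x \<in> L \<Longrightarrow> y \<in> L \<Longrightarrow> br x y \<in> L"
    using ad unfolding nil_action_def by blast+
  have skew: "br y x = - br x y" for x y
  proof -
    have "br (x + y) (x + y) = (br x x + br y x) + (br x y + br y y)"
      by (simp only: lin_simps(1)[OF br(1)] lin_simps(1)[OF br(2)])
    then have "br x y + br y x = 0" by (simp add: alt add.commute)
    then show ?thesis by (simp add: eq_neg_iff_add_eq_0 add.commute)
  qed
  show ?case
  proof (cases "L = {0}")
    case True
    then show ?thesis
      using \<open>V \<noteq> W\<close> W by (auto simp: lin_simps[OF op(2)] subspace_0)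
  next
    case False
    define Q where "Q K \<longleftrightarrow> subspace K \<and> K \<subseteq> L \<and> K \<noteq> L \<and> (\<forall>x\<in>K. \<forall>y\<in>K. br x y \<in> K)" for K
    have "Q {0}" using False subspace_0[OF L] by (auto simp: Q_def alt)
    then obtain K where "Q K" and K_max: "\<And>T. Q T \<Longrightarrow> K \<subseteq> T \<Longrightarrow> T = K"
      using maximal_subspace_exists[of Q "{0}"] by (metis Q_def)
    then have K: "subspace K" "K \<subseteq> L" "K \<noteq> L" "\<And>x y. x \<in> K \<Longrightarrow> y \<in> K \<Longrightarrow> br x y \<in> K"
      by (auto simp: Q_def)
    have "dim K < dim L"
      using subspace_dim_equal[OF K(1) L K(2)] K(3) by force
    have jac: "\<And>x y z. x \<in> L \<Longrightarrow> y \<in> L \<Longrightarrow> z \<in> L \<Longrightarrow> br x (br y z) = br (br x y) z + br y (br x z)"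
      and nil: "\<And>x z. x \<in> L \<Longrightarrow> z \<in> L \<Longrightarrow> \<exists>n. (br x ^^ n) z = 0"
      using ad unfolding nil_action_def by blast+
    have KK: "nil_action br K K {0} br"
      unfolding nil_action_def
    proof (intro conjI)
      show "\<forall>x\<in>K. \<forall>y\<in>K. \<forall>v\<in>K. br x (br y v) = br (br x y) v + br y (br x v)"
        using K(2) jac by blast
      show "\<forall>x\<in>K. \<forall>v\<in>K. \<exists>n. (br x ^^ n) v \<in> {0}" using K(2) nil by blast
    qed (use br(1,2) K(1,4) subspace_0[OF K(1)] in \<open>auto simp: lin_simps[OF br(1)]\<close>)
    have KL: "nil_action br K L K br"
      unfolding nil_action_def
    proof (intro conjI)
      show "\<forall>x\<in>K. \<forall>y\<in>K. \<forall>v\<in>L. br x (br y v) = br (br x y) v + br y (br x v)"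
        using K(2) jac by blast
      show "\<forall>x\<in>K. \<forall>v\<in>L. \<exists>n. (br x ^^ n) v \<in> K"
        using K(2) nil subspace_0[OF K(1)] by (metis subsetD)
    qed (use br K L in auto)
    obtain y where y: "y \<in> L" "y \<notin> K" and Ky: "\<And>x. x \<in> K \<Longrightarrow> br x y \<in> K"
      using less.hyps[OF \<open>dim K < dim L\<close> K(1) KK KL] K(3) by blast
    define K' where "K' = {x. \<exists>c. x - scale c y \<in> K}"
    have K': "K' = span (insert y K)"
      using K(1) by (simp add: K'_def span_insert span_eq_iff[THEN iffD2])
    have "K \<subseteq> K'" "y \<in> K'" by (auto simp: K' intro: span_base)
    have "K' \<subseteq> L" unfolding K' using K(2) y L by (intro span_minimal) auto
    have "K' = L"
    proof (rule ccontr)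
      assume "K' \<noteq> L"
      have "br u v \<in> K'" if uv: "u \<in> K'" "v \<in> K'" for u v
      proof -
        obtain c d where c: "u - scale c y \<in> K" and d: "v - scale d y \<in> K"
          using uv by (auto simp: K'_def)
        have "br u v = br ((u - scale c y) + scale c y) ((v - scale d y) + scale d y)" by simp
        also have "\<dots> = br (u - scale c y) (v - scale d y) + scale d (br (u - scale c y) y)
            - scale c (br (v - scale d y) y)"
          unfolding lin_simps(1,4)[OF br(1)] lin_simps(1,4)[OF br(2)]
          by (simp add: alt skew[of "v - scale d y" y])
        also have "\<dots> \<in> K"
          by (intro subspace_diff[OF K(1)] subspace_add[OF K(1)] subspace_scale[OF K(1)]
              K(4)[OF c d] Ky[OF c] Ky[OF d])
        finally show ?thesis using \<open>K \<subseteq> K'\<close> by blast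
      qed
      then have "Q K'"
        using \<open>K' \<noteq> L\<close> \<open>K' \<subseteq> L\<close> unfolding Q_def by (auto simp: K')
      then show False using K_max[OF _ \<open>K \<subseteq> K'\<close>] \<open>y \<in> K'\<close> y by blast
    qed
    define T where "T = {v \<in> V. \<forall>x\<in>K. op x v \<in> W}"
    have "nil_action br K V W op"
      using act K(2) by (rule nil_action_mono)
    then obtain v where v: "v \<in> T" "v \<notin> W"
      using less.hyps[OF \<open>dim K < dim L\<close> K(1) KK, of V W op] \<open>V \<noteq> W\<close> unfolding T_def by auto
    have T_y: "op y u \<in> T" if u: "u \<in> T" for u
      unfolding T_def
    proof (safe)
      show "op y u \<in> V" using act y u unfolding nil_action_def T_def by blast
      fix x assume x: "x \<in> K"
      have "op x (op y u) = op (br x y) u + op y (op x u)"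
        using act K(2) x y u unfolding nil_action_def T_def by blast
      moreover have "op (br x y) u \<in> W" "op x u \<in> W" using u x Ky by (auto simp: T_def)
      moreover have "op y (op x u) \<in> W"
        using act y \<open>op x u \<in> W\<close> unfolding nil_action_def by blast
      ultimately show "op x (op y u) \<in> W" using subspace_add[OF W(1)] by simp
    qed
    have T_pow: "(op y ^^ n) v \<in> T" for n
      by (induction n) (auto simp: v T_y)
    have "\<exists>n. (op y ^^ n) v \<in> W" using act y v unfolding nil_action_def T_def by blast
    then obtain n where n: "(op y ^^ n) v \<in> W" "\<And>m. m < n \<Longrightarrow> (op y ^^ m) v \<notin> W"
      using exists_least_iff[of "\<lambda>n. (op y ^^ n) v \<in> W"] by blast
    obtain m where m: "n = Suc m" using n(1) v(2) by (cases n) auto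
    define u where "u = (op y ^^ m) v"
    have u: "u \<in> T" "u \<notin> W" "op y u \<in> W" using n T_pow[of m] by (auto simp: u_def m)
    have "op x u \<in> W" if x: "x \<in> L" for x
    proof -
      obtain c where c: "x - scale c y \<in> K" using x \<open>K' = L\<close> K'_def by blast
      have "op x u = op (x - scale c y) u + scale c (op y u)"
        by (simp add: lin_simps[OF op(2)])
      then show ?thesis
        using c u subspace_add[OF W(1)] subspace_scale[OF W(1)] by (simp add: T_def)
    qed
    then show ?thesis using u by (auto simp: T_def)
  qed
qed

section \<open>Commutators in characteristic zero\<close>

text \<open>The polynomial \<open>p\<close> in the operator \<open>f\<close>, applied to \<open>v\<close> by Horner's scheme.\<close>

definition poly_op :: "('b \<Rightarrow> 'b) \<Rightarrow> 'a poly \<Rightarrow> 'b \<Rightarrow> 'b" where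
  "poly_op f p v = fold_coeffs (\<lambda>c w. scale c v + f w) p 0"

lemma poly_op_zero [simp]: "poly_op f 0 v = 0"
  by (simp add: poly_op_def)

context
  fixes f assumes f: "lin f"
begin

lemma poly_op_pCons [simp]: "poly_op f (pCons c p) v = scale c v + f (poly_op f p v)"
  by (cases "p = 0 \<and> c = 0") (auto simp: poly_op_def lin_simps[OF f] fold_coeffs_pCons_coeff_not_0_eq fold_coeffs_pCons_not_0_0_eq)

lemma poly_op_add: "poly_op f (p + q) v = poly_op f p v + poly_op f q v"
  by (induction p q rule: poly_induct2) (auto simp: lin_simps[OF f] scale_left_distrib)

lemma poly_op_smult: "poly_op f (smult c p) v = scale c (poly_op f p v)"
  by (induction p) (auto simp: lin_simps[OF f] scale_right_distrib)

lemma poly_op_mult: "poly_op f (p * q) v = poly_op f p (poly_op f q v)"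
  by (induction p) (auto simp: poly_op_add poly_op_smult)

lemma poly_op_diff: "poly_op f (p - q) v = poly_op f p v - poly_op f q v"
  using poly_op_add[of "p - q" q v] by simp

lemma poly_op_monom: "poly_op f (monom 1 n) v = (f ^^ n) v"
  by (induction n) (auto simp: monom_0 monom_Suc lin_simps[OF f])

lemma lin_poly_op: "lin (poly_op f p)"
proof (induction p)
  case 0
  show ?case by (auto simp: Vector_Spaces.linear_iff vector_space_axioms)
next
  case (pCons c p)
  then show ?case
    unfolding Vector_Spaces.linear_iff poly_op_pCons lin_simps(1,4)[OF pCons(2)]
    by (simp add: lin_simps[OF f] algebra_simps vector_space_axioms)
qed

lemma poly_op_commute:
  assumes "lin h" "\<And>v. h (f v) = f (h v)"
  shows "h (poly_op f p v) = poly_op f p (h v)"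
  by (induction p) (auto simp: lin_simps[OF assms(1)] assms(2))

text \<open>Otherwise \<open>v, f v, f\<^sup>2 v, \<dots>\<close> would all be linearly independent.\<close>

lemma annihilating_poly_at: "\<exists>p. p \<noteq> 0 \<and> poly_op f p v = 0"
proof (rule ccontr)
  assume "\<nexists>p. p \<noteq> 0 \<and> poly_op f p v = 0"
  then have no: "poly_op f p v = 0 \<Longrightarrow> p = 0" for p by blast
  define E where "E n = (\<lambda>i. (f ^^ i) v) ` {..<n}" for n
  have "independent (E n) \<and> card (E n) = n" for n
  proof (induction n)
    case 0
    then show ?case by (simp add: E_def independent_empty)
  next
    case (Suc n)
    define S where "S = (\<lambda>p. poly_op f p v) ` {p. \<forall>i\<ge>n. coeff p i = 0}"
    have "subspace S"
    proof (rule subspaceI)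
      show "0 \<in> S" by (auto simp: S_def image_iff intro!: exI[of _ 0])
      fix x y c assume "x \<in> S" "y \<in> S"
      then obtain p q where "x = poly_op f p v" "y = poly_op f q v"
        "\<forall>i\<ge>n. coeff p i = 0" "\<forall>i\<ge>n. coeff q i = 0" by (auto simp: S_def)
      then show "x + y \<in> S"
        unfolding S_def by (auto intro!: image_eqI[of _ _ "p + q"] simp: poly_op_add)
      show "scale c x \<in> S"
        using \<open>x = _\<close> \<open>\<forall>i\<ge>n. coeff p i = 0\<close>
        unfolding S_def by (auto intro!: image_eqI[of _ _ "smult c p"] simp: poly_op_smult)
    qed
    moreover have "E n \<subseteq> S"
      by (auto simp: E_def S_def poly_op_monom[symmetric] intro!: imageI)
    ultimately have "span (E n) \<subseteq> S" by (simp add: span_minimal)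
    moreover have "(f ^^ n) v \<notin> S"
    proof
      assume "(f ^^ n) v \<in> S"
      then obtain p where p: "(f ^^ n) v = poly_op f p v" "\<forall>i\<ge>n. coeff p i = 0"
        by (auto simp: S_def)
      then have "poly_op f (monom 1 n - p) v = 0" by (simp add: poly_op_diff poly_op_monom)
      then have "coeff (monom 1 n - p) n = 0" using no by (metis coeff_0)
      then show False using p(2) by simp
    qed
    ultimately have new: "(f ^^ n) v \<notin> span (E n)" by blast
    have "E (Suc n) = insert ((f ^^ n) v) (E n)" by (simp add: E_def lessThan_Suc)
    moreover have "(f ^^ n) v \<notin> E n" using new span_base by blast
    moreover have "finite (E n)" by (simp add: E_def)
    ultimately show ?case using Suc new by (simp add: independent_insert)
  qed
  from this[of "Suc dimension"] show False
    using independent_card_le_dim[of "E (Suc dimension)" UNIV] by (simp add: dimension_def)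
qed

text \<open>The product of polynomials that annihilate the single basis vectors.\<close>

lemma annihilating_poly: "\<exists>p. p \<noteq> 0 \<and> (\<forall>v. poly_op f p v = 0)"
proof -
  have "\<exists>p. p \<noteq> 0 \<and> (\<forall>v\<in>S. poly_op f p v = 0)" if "finite S" for S
    using that
  proof (induction S)
    case empty
    show ?case by (auto intro: exI[of _ 1])
  next
    case (insert v S)
    then obtain p where p: "p \<noteq> 0" "\<forall>v\<in>S. poly_op f p v = 0" by blast
    obtain q where q: "q \<noteq> 0" "poly_op f q (poly_op f p v) = 0" using annihilating_poly_at by blast
    show ?case
      using p q by (intro exI[of _ "q * p"]) (auto simp: poly_op_mult lin_simps[OF lin_poly_op])
  qed
  then obtain p where p: "p \<noteq> 0" "\<forall>v\<in>Basis. poly_op f p v = 0" using finite_Basis by blast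
  have "span Basis \<subseteq> {v. poly_op f p v \<in> {0}}"
    using p by (intro span_minimal subspace_preimage lin_poly_op) auto
  then show ?thesis using p span_Basis by auto
qed

text \<open>If \<open>h = [l, f]\<close> commutes with \<open>f\<close>, then bracketing with \<open>l\<close> acts on polynomials in \<open>f\<close> as
  \<open>p \<mapsto> p' h\<close>.\<close>

lemma poly_op_pderiv:
  assumes "lin l" "lin h" and comm: "\<And>v. l (f v) = f (l v) + h v" "\<And>v. h (f v) = f (h v)"
  shows "l (poly_op f p v) = poly_op f p (l v) + poly_op f (pderiv p) (h v)"
proof (induction p)
  case 0
  then show ?case by (simp add: lin_simps[OF assms(1)])
next
  case (pCons c p)
  then show ?case
    by (simp add: lin_simps[OF assms(1)] lin_simps[OF f] comm pderiv_pCons poly_op_add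
        poly_op_commute[OF assms(2) comm(2)])
qed

text \<open>Jacobson's lemma. Starting from \<open>p(f) = 0\<close>, bracketing with \<open>l\<close> gives in turn \<open>p'(f) h = 0\<close>,
  \<open>p''(f) h\<^sup>3 = 0\<close> and so on, until only a nonzero constant is left in front of a power
  of \<open>h\<close>; this is where characteristic zero enters.\<close>

lemma commutator_nilpotent:
  assumes "CHAR('a) = 0"
    and "lin l" "lin h" and comm: "\<And>v. l (f v) = f (l v) + h v" "\<And>v. h (f v) = f (h v)"
  shows "null_component h = UNIV"
proof -
  have hf: "(h ^^ n) (f v) = f ((h ^^ n) v)" for n v
    by (induction n) (simp_all add: comm)
  have *: "\<exists>n. \<forall>v. (h ^^ n) v = 0" if "p \<noteq> 0" "\<forall>v. poly_op f p ((h ^^ j) v) = 0" for p j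
    using that
  proof (induction "degree p" arbitrary: p j)
    case 0
    then obtain c where "p = [:c:]" using degree_eq_zeroE by metis
    then show ?case using 0 by (auto simp: lin_simps[OF f])
  next
    case (Suc d)
    have "coeff (pderiv p) d \<noteq> 0"
      using Suc.hyps(2) Suc.prems(1) assms(1) leading_coeff_0_iff[of p]
      by (simp add: coeff_pderiv of_nat_eq_0_iff_char_dvd del: of_nat_Suc leading_coeff_0_iff)
    moreover have "degree (pderiv p) \<le> d"
      using Suc.hyps(2) by (intro degree_le) (auto simp: coeff_pderiv coeff_eq_0)
    ultimately have deg: "d = degree (pderiv p)" "pderiv p \<noteq> 0"
      using le_degree[of "pderiv p" d] by auto
    have "poly_op f (pderiv p) ((h ^^ Suc (j + j)) v) = 0" for v
    proof -
      let ?u = "(h ^^ j) v"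
      \<comment> \<open>\<open>l\<close> separates \<open>p(f)\<close> from \<open>h\<^sup>j\<close>, and only another factor \<open>h\<^sup>j\<close> on the left makes
        \<open>p(f) l h\<^sup>j v\<close> vanish; this is why the exponent \<open>j\<close> turns into \<open>2 j + 1\<close>.\<close>
      have "(h ^^ j) (poly_op f p (l ?u)) = poly_op f p ((h ^^ j) (l ?u))"
        by (rule poly_op_commute[OF lin_funpow[OF assms(3)] hf])
      also have "\<dots> = 0" using Suc.prems(2) by blast
      finally have "(h ^^ j) (poly_op f (pderiv p) (h ?u)) = 0"
        using poly_op_pderiv[OF assms(2-5), of p ?u] Suc.prems(2)
          lin_simps[OF assms(2)] lin_simps[OF lin_funpow[OF assms(3)], of j]
        by (simp add: add_eq_0_iff)
      then show ?thesis
        by (simp add: poly_op_commute[OF lin_funpow[OF assms(3)] hf] funpow_add funpow_swap1)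
    qed
    then show ?case using Suc.hyps(1)[OF deg] by blast
  qed
  obtain p where "p \<noteq> 0" "\<forall>v. poly_op f p v = 0" using annihilating_poly by blast
  then show ?thesis using *[of p 0] by (auto simp: null_component_def)
qed

end

end

section \<open>Products of ideals of a Poisson algebra\<close>

locale fin_dim_poisson_algebra =
  poisson_algebra scale mult brk + finite_dimensional_vector_space scale Basis
  for scale :: "'k::field \<Rightarrow> 'p::ab_group_add \<Rightarrow> 'p"
    and mult :: "'p \<Rightarrow> 'p \<Rightarrow> 'p"  (infixl \<open>\<cdot>\<close> 70)
    and brk :: "'p \<Rightarrow> 'p \<Rightarrow> 'p"  (\<open>\<lbrace>_, _\<rbrace>\<close>)
    and Basis :: "'p set"
begin

lemmas mult_simps = lin_simps[OF mult_linear_right] lin_simps[OF mult_linear_left]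
lemmas brk_simps = lin_simps[OF brk_linear_right] lin_simps[OF brk_linear_left]

lemma brk_skew: "\<lbrace>y, x\<rbrace> = - \<lbrace>x, y\<rbrace>"
proof -
  have "\<lbrace>x + y, x + y\<rbrace> = (\<lbrace>x, x\<rbrace> + \<lbrace>y, x\<rbrace>) + (\<lbrace>x, y\<rbrace> + \<lbrace>y, y\<rbrace>)"
    by (simp only: brk_simps(1,6))
  then have "\<lbrace>y, x\<rbrace> + \<lbrace>x, y\<rbrace> = 0" by (simp add: brk_alternating)
  then show ?thesis by (simp add: eq_neg_iff_add_eq_0)
qed

lemma brk_mult_right: "\<lbrace>x, y \<cdot> z\<rbrace> = \<lbrace>x, y\<rbrace> \<cdot> z + y \<cdot> \<lbrace>x, z\<rbrace>"
proof -
  have "\<lbrace>x, y \<cdot> z\<rbrace> = - \<lbrace>y \<cdot> z, x\<rbrace>" by (rule brk_skew)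
  also have "\<dots> = \<lbrace>x, y\<rbrace> \<cdot> z + y \<cdot> \<lbrace>x, z\<rbrace>"
    by (simp add: leibniz brk_skew[of y x] brk_skew[of z x] mult_simps)
  finally show ?thesis .
qed

lemma brk_brk: "\<lbrace>x, \<lbrace>y, z\<rbrace>\<rbrace> = \<lbrace>\<lbrace>x, y\<rbrace>, z\<rbrace> + \<lbrace>y, \<lbrace>x, z\<rbrace>\<rbrace>"
  using jacobi[of x y z]
  by (simp add: brk_skew[of z x] brk_skew[of z "\<lbrace>x, y\<rbrace>"] brk_simps algebra_simps)

definition alg_product :: "'p set \<Rightarrow> 'p set \<Rightarrow> 'p set" where
  "alg_product S T = mult_space S T + brk_space S T"

lemma square_eq_alg_product: "square S = alg_product S S"
  by (simp add: square_def alg_product_def)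

lemma subspace_mult_space: "subspace (mult_space S T)"
  by (simp add: mult_space_def)

lemma subspace_alg_product: "subspace (alg_product S T)"
  by (simp add: alg_product_def mult_space_def brk_space_def subspace_plus)

lemma span_subset_iff: "subspace W \<Longrightarrow> span X \<subseteq> W \<longleftrightarrow> X \<subseteq> W"
  by (meson span_minimal span_superset subset_trans)

lemma mult_space_subset_iff:
  "subspace W \<Longrightarrow> mult_space S T \<subseteq> W \<longleftrightarrow> (\<forall>x\<in>S. \<forall>y\<in>T. x \<cdot> y \<in> W)"
  unfolding mult_space_def by (subst span_subset_iff) auto

lemma alg_product_subset_iff:
  assumes "subspace W"
  shows "alg_product S T \<subseteq> W \<longleftrightarrow> (\<forall>x\<in>S. \<forall>y\<in>T. x \<cdot> y \<in> W \<and> \<lbrace>x, y\<rbrace> \<in> W)"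
proof -
  have "brk_space S T \<subseteq> W \<longleftrightarrow> (\<forall>x\<in>S. \<forall>y\<in>T. \<lbrace>x, y\<rbrace> \<in> W)"
    unfolding brk_space_def by (subst span_subset_iff[OF assms]) auto
  then show ?thesis
    using mult_space_subset_iff[OF assms] assms
    by (auto simp: alg_product_def plus_subset_iff mult_space_def brk_space_def)
qed

lemma mult_spaceI: "x \<in> S \<Longrightarrow> y \<in> T \<Longrightarrow> x \<cdot> y \<in> mult_space S T"
  using mult_space_subset_iff[OF subspace_mult_space, of S T S T] by blast

lemma alg_productI:
  assumes "x \<in> S" "y \<in> T"
  shows "x \<cdot> y \<in> alg_product S T" "\<lbrace>x, y\<rbrace> \<in> alg_product S T"
  using alg_product_subset_iff[OF subspace_alg_product, of S T S T] assms by blast+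

lemma alg_product_mono: "S \<subseteq> S' \<Longrightarrow> T \<subseteq> T' \<Longrightarrow> alg_product S T \<subseteq> alg_product S' T'"
  by (subst alg_product_subset_iff) (auto intro: alg_productI subspace_alg_product)

lemma span_preimage:
  assumes "lin f" "subspace W" "\<And>x. x \<in> X \<Longrightarrow> f x \<in> W" "x \<in> span X"
  shows "f x \<in> W"
  using span_minimal[OF _ subspace_preimage[OF assms(1,2)], of X] assms(3,4) by auto

lemma alg_product_span_subset:
  assumes W: "subspace W" and "\<And>x y. x \<in> X \<Longrightarrow> y \<in> Y \<Longrightarrow> x \<cdot> y \<in> W \<and> \<lbrace>x, y\<rbrace> \<in> W"
  shows "alg_product (span X) (span Y) \<subseteq> W"
proof -
  have "x \<cdot> y \<in> W" "\<lbrace>x, y\<rbrace> \<in> W" if "x \<in> X" "y \<in> span Y" for x y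
    by (rule span_preimage[OF _ W _ that(2)]; use assms that in \<open>simp add: mult_linear_right brk_linear_right\<close>)+
  then have "x \<cdot> y \<in> W" "\<lbrace>x, y\<rbrace> \<in> W" if "x \<in> span X" "y \<in> span Y" for x y
    using span_preimage[OF mult_linear_left W _ that(1)] span_preimage[OF brk_linear_left W _ that(1)]
      that(2) by simp_all
  then show ?thesis by (subst alg_product_subset_iff[OF W]) simp
qed

lemma square_eq_0_iff:
  "subspace S \<Longrightarrow> square S = {0} \<longleftrightarrow> (\<forall>x\<in>S. \<forall>y\<in>S. x \<cdot> y = 0 \<and> \<lbrace>x, y\<rbrace> = 0)"
  using alg_product_subset_iff[of "{0}" S S] subspace_0[OF subspace_alg_product, of S S]
  by (auto simp: square_eq_alg_product)

definition ideal_in :: "'p set \<Rightarrow> 'p set \<Rightarrow> bool" where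
  "ideal_in U I \<longleftrightarrow> subspace I \<and> I \<subseteq> U \<and> (\<forall>x\<in>I. \<forall>u\<in>U. x \<cdot> u \<in> I \<and> \<lbrace>x, u\<rbrace> \<in> I)"

lemma ideal_iff: "ideal I \<longleftrightarrow> ideal_in UNIV I"
  using alg_product_subset_iff[of I I UNIV]
  by (auto simp: ideal_def ideal_in_def alg_product_def[symmetric])

lemma ideal_inD:
  assumes "ideal_in U I"
  shows "subspace I" "I \<subseteq> U"
    "x \<in> I \<Longrightarrow> u \<in> U \<Longrightarrow> x \<cdot> u \<in> I" "x \<in> I \<Longrightarrow> u \<in> U \<Longrightarrow> u \<cdot> x \<in> I"
    "x \<in> I \<Longrightarrow> u \<in> U \<Longrightarrow> \<lbrace>x, u\<rbrace> \<in> I" "x \<in> I \<Longrightarrow> u \<in> U \<Longrightarrow> \<lbrace>u, x\<rbrace> \<in> I"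
proof -
  show *: "subspace I" "I \<subseteq> U"
    "x \<in> I \<Longrightarrow> u \<in> U \<Longrightarrow> x \<cdot> u \<in> I" "x \<in> I \<Longrightarrow> u \<in> U \<Longrightarrow> \<lbrace>x, u\<rbrace> \<in> I"
    using assms by (auto simp: ideal_in_def)
  show "x \<in> I \<Longrightarrow> u \<in> U \<Longrightarrow> u \<cdot> x \<in> I" "x \<in> I \<Longrightarrow> u \<in> U \<Longrightarrow> \<lbrace>u, x\<rbrace> \<in> I"
    using * by (simp_all add: mult_commute[of u] brk_skew[of u] subspace_neg)
qed

lemma idealI:
  assumes "subspace I" "\<And>x y. x \<in> I \<Longrightarrow> x \<cdot> y \<in> I" "\<And>x y. x \<in> I \<Longrightarrow> \<lbrace>x, y\<rbrace> \<in> I"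
  shows "ideal I"
  using assms by (simp add: ideal_iff ideal_in_def)

lemma idealD:
  assumes "ideal I"
  shows "subspace I" "x \<in> I \<Longrightarrow> x \<cdot> u \<in> I" "x \<in> I \<Longrightarrow> u \<cdot> x \<in> I"
    "x \<in> I \<Longrightarrow> \<lbrace>x, u\<rbrace> \<in> I" "x \<in> I \<Longrightarrow> \<lbrace>u, x\<rbrace> \<in> I"
  using ideal_inD(1,3-6)[OF assms[unfolded ideal_iff]] by auto

lemma ideal_0: "ideal {0}"
  by (rule idealI) (auto simp: mult_simps brk_simps)

lemma ideal_UNIV: "ideal UNIV"
  by (rule idealI) auto

lemma ideal_Int: "ideal I \<Longrightarrow> ideal J \<Longrightarrow> ideal (I \<inter> J)"
  by (rule idealI) (auto intro: idealD subspace_inter)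

lemma ideal_plus:
  assumes "ideal I" "ideal J"
  shows "ideal (I + J)"
proof (rule idealI)
  show "subspace (I + J)" using assms by (intro subspace_plus idealD)
  fix x y assume "x \<in> I + J"
  then obtain a b where "x = a + b" "a \<in> I" "b \<in> J" by (rule set_plus_elim)
  moreover have "x \<cdot> y = a \<cdot> y + b \<cdot> y" "\<lbrace>x, y\<rbrace> = \<lbrace>a, y\<rbrace> + \<lbrace>b, y\<rbrace>"
    by (simp_all add: \<open>x = a + b\<close> mult_simps brk_simps)
  ultimately show "x \<cdot> y \<in> I + J" "\<lbrace>x, y\<rbrace> \<in> I + J"
    using assms by (simp_all add: set_plus_intro idealD)
qed

lemma subalgebra_ideal_plus:
  assumes "ideal I" "subalgebra S"
  shows "subalgebra (I + S)"
  unfolding subalgebra_def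
proof (intro conjI ballI)
  show "subspace (I + S)" using assms by (auto intro: subspace_plus idealD simp: subalgebra_def)
  fix x y assume "x \<in> I + S" "y \<in> I + S"
  then obtain a b c d where *: "x = a + b" "a \<in> I" "b \<in> S" "y = c + d" "c \<in> I" "d \<in> S"
    by (auto elim!: set_plus_elim)
  have "x \<cdot> y = (a \<cdot> y + b \<cdot> c) + b \<cdot> d" "\<lbrace>x, y\<rbrace> = (\<lbrace>a, y\<rbrace> + \<lbrace>b, c\<rbrace>) + \<lbrace>b, d\<rbrace>"
    by (simp_all add: * mult_simps brk_simps)
  moreover have "a \<cdot> y + b \<cdot> c \<in> I" "\<lbrace>a, y\<rbrace> + \<lbrace>b, c\<rbrace> \<in> I"
    using assms(1) *(2,5) by (simp_all add: subspace_add idealD)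
  moreover have "b \<cdot> d \<in> S" "\<lbrace>b, d\<rbrace> \<in> S" using assms(2) * by (simp_all add: subalgebra_def)
  ultimately show "x \<cdot> y \<in> I + S" "\<lbrace>x, y\<rbrace> \<in> I + S" by (simp_all add: set_plus_intro)
qed

lemma subalgebra_Int: "subalgebra S \<Longrightarrow> subalgebra T \<Longrightarrow> subalgebra (S \<inter> T)"
  by (auto simp: subalgebra_def intro: subspace_inter)

text \<open>For the bracket of two ideals this rests on \<open>\<lbrace>x, y\<rbrace> \<cdot> u = \<lbrace>x \<cdot> u, y\<rbrace> - x \<cdot> \<lbrace>u, y\<rbrace>\<close>, which
  leaves the bracket space and needs the associative product as the second summand.\<close>

lemma ideal_in_alg_product:
  assumes I: "ideal_in U I" and J: "ideal_in U J"
  shows "ideal_in U (alg_product I J)"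
  unfolding ideal_in_def
proof (intro conjI ballI)
  let ?P = "alg_product I J"
  show sub: "subspace ?P" by (rule subspace_alg_product)
  show "?P \<subseteq> U"
  proof -
    have "?P \<subseteq> J"
      unfolding alg_product_subset_iff[OF ideal_inD(1)[OF J]]
      using ideal_inD(2)[OF I] by (auto intro: ideal_inD(4,6)[OF J])
    then show ?thesis using ideal_inD(2)[OF J] by simp
  qed
  fix w u assume w: "w \<in> ?P" and u: "u \<in> U"
  have "?P \<subseteq> {w. w \<cdot> u \<in> ?P}"
  proof (subst alg_product_subset_iff, safe)
    fix x y assume xy: "x \<in> I" "y \<in> J"
    show "x \<cdot> y \<cdot> u \<in> ?P" using xy u by (simp add: mult_assoc alg_productI ideal_inD[OF J])
    have "\<lbrace>x, y\<rbrace> \<cdot> u = \<lbrace>x \<cdot> u, y\<rbrace> - x \<cdot> \<lbrace>u, y\<rbrace>" by (simp add: leibniz)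
    then show "\<lbrace>x, y\<rbrace> \<cdot> u \<in> ?P"
      using xy u by (simp add: subspace_diff[OF sub] alg_productI ideal_inD[OF I] ideal_inD[OF J])
  qed (intro subspace_preimage[OF mult_linear_left sub])
  then show "w \<cdot> u \<in> ?P" using w by blast
  have "?P \<subseteq> {w. \<lbrace>w, u\<rbrace> \<in> ?P}"
  proof (subst alg_product_subset_iff, safe)
    fix x y assume xy: "x \<in> I" "y \<in> J"
    show "\<lbrace>x \<cdot> y, u\<rbrace> \<in> ?P"
      using xy u by (simp add: leibniz subspace_add[OF sub] alg_productI ideal_inD[OF I] ideal_inD[OF J])
    have "\<lbrace>\<lbrace>x, y\<rbrace>, u\<rbrace> = \<lbrace>x, \<lbrace>y, u\<rbrace>\<rbrace> + \<lbrace>\<lbrace>x, u\<rbrace>, y\<rbrace>"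
      using brk_brk[of x y u] brk_skew[of "\<lbrace>x, u\<rbrace>" y] by simp
    then show "\<lbrace>\<lbrace>x, y\<rbrace>, u\<rbrace> \<in> ?P"
      using xy u by (simp add: subspace_add[OF sub] alg_productI ideal_inD[OF I] ideal_inD[OF J])
  qed (intro subspace_preimage[OF brk_linear_left sub])
  then show "\<lbrace>w, u\<rbrace> \<in> ?P" using w by blast
qed

lemma ideal_alg_product: "ideal I \<Longrightarrow> ideal J \<Longrightarrow> ideal (alg_product I J)"
  by (simp add: ideal_iff ideal_in_alg_product)

lemma ideal_mult_space:
  assumes "ideal I" "ideal J"
  shows "ideal (mult_space I J)"
proof (rule idealI)
  let ?P = "mult_space I J"
  show sub: "subspace ?P" by (rule subspace_mult_space)
  fix w u assume w: "w \<in> ?P"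
  have "?P \<subseteq> {w. w \<cdot> u \<in> ?P}" "?P \<subseteq> {w. \<lbrace>w, u\<rbrace> \<in> ?P}"
    by (subst mult_space_subset_iff;
        simp add: mult_assoc leibniz mult_spaceI idealD assms subspace_add[OF sub]
          subspace_preimage[OF mult_linear_left sub] subspace_preimage[OF brk_linear_left sub])+
  then show "w \<cdot> u \<in> ?P" "\<lbrace>w, u\<rbrace> \<in> ?P" using w by blast+
qed

lemma alg_product_ideal_subset:
  assumes "ideal I"
  shows "alg_product I S \<subseteq> I" "alg_product S I \<subseteq> I"
  by (subst alg_product_subset_iff; auto intro: idealD assms)+

lemma zero_idealD:
  assumes "zero_ideal I"
  shows "ideal I" "x \<in> I \<Longrightarrow> y \<in> I \<Longrightarrow> x \<cdot> y = 0" "x \<in> I \<Longrightarrow> y \<in> I \<Longrightarrow> \<lbrace>x, y\<rbrace> = 0"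
  using assms square_eq_0_iff[of I] idealD(1)[of I] by (auto simp: zero_ideal_def)

lemma zero_idealI:
  assumes "ideal I" "\<And>x y. x \<in> I \<Longrightarrow> y \<in> I \<Longrightarrow> x \<cdot> y = 0" "\<And>x y. x \<in> I \<Longrightarrow> y \<in> I \<Longrightarrow> \<lbrace>x, y\<rbrace> = 0"
  shows "zero_ideal I"
  using assms square_eq_0_iff[of I] idealD(1)[of I] by (auto simp: zero_ideal_def)

lemma zero_ideal_subset: "zero_ideal J \<Longrightarrow> ideal I \<Longrightarrow> I \<subseteq> J \<Longrightarrow> zero_ideal I"
  by (rule zero_idealI) (auto dest: zero_idealD)

lemma minimal_ideal_exists:
  assumes "ideal J" "J \<noteq> {0}"
  obtains I where "minimal_ideal I" "I \<subseteq> J"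
proof (rule minimal_subspace_exists[of "\<lambda>I. ideal I \<and> I \<noteq> {0}" J])
  show "ideal J \<and> J \<noteq> {0}" using assms by simp
  show "subspace T" if "ideal T \<and> T \<noteq> {0}" for T using that idealD(1) by simp
  fix I
  assume I: "ideal I \<and> I \<noteq> {0}" "I \<subseteq> J" "\<And>T. ideal T \<and> T \<noteq> {0} \<Longrightarrow> T \<subseteq> I \<Longrightarrow> T = I"
  have "minimal_ideal I" unfolding minimal_ideal_def using I(1,3) by metis
  then show thesis using that[of I] I(2) by simp
qed

section \<open>The radical and the nilradical\<close>

lemma derived_ideal: "ideal I \<Longrightarrow> ideal (derived I n)"
  by (induction n) (simp_all add: square_eq_alg_product ideal_alg_product)

lemma derived_add: "derived A (m + n) = derived (derived A m) n"
  by (induction n) simp_all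

lemma derived_mono: "A \<subseteq> B \<Longrightarrow> derived A n \<subseteq> derived B n"
  by (induction n) (auto simp: square_eq_alg_product intro: alg_product_mono[THEN subsetD])

text \<open>Modulo \<open>I\<close>, the derived series of \<open>I + J\<close> is that of \<open>J\<close>. It reaches \<open>I\<close> and then continues
  inside the derived series of \<open>I\<close>.\<close>

lemma solvable_plus:
  assumes "ideal I" "solvable I" "ideal J" "solvable J"
  shows "solvable (I + J)"
proof -
  obtain m n where m: "derived I m = {0}" and n: "derived J n = {0}"
    using assms by (auto simp: solvable_def)
  have "derived (I + J) k \<subseteq> I + derived J k" for k
  proof (induction k)
    case (Suc k)
    have J: "subspace (derived J k)" by (intro idealD derived_ideal assms)
    have *: "subspace (I + alg_product (derived J k) (derived J k))"
      by (intro subspace_plus idealD(1) assms subspace_alg_product)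
    have "alg_product (I + derived J k) (I + derived J k)
        \<subseteq> I + alg_product (derived J k) (derived J k)"
    proof (subst alg_product_subset_iff[OF *], intro ballI)
      fix x y assume "x \<in> I + derived J k" "y \<in> I + derived J k"
      then obtain a b c d where *: "x = a + b" "a \<in> I" "b \<in> derived J k"
          "y = c + d" "c \<in> I" "d \<in> derived J k" by (auto elim!: set_plus_elim)
      have "x \<cdot> y = (a \<cdot> y + b \<cdot> c) + b \<cdot> d" "\<lbrace>x, y\<rbrace> = (\<lbrace>a, y\<rbrace> + \<lbrace>b, c\<rbrace>) + \<lbrace>b, d\<rbrace>"
        by (simp_all add: * mult_simps brk_simps)
      moreover have "a \<cdot> y + b \<cdot> c \<in> I" "\<lbrace>a, y\<rbrace> + \<lbrace>b, c\<rbrace> \<in> I"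
        using *(2,5) assms(1) by (simp_all add: subspace_add idealD)
      ultimately show "x \<cdot> y \<in> I + alg_product (derived J k) (derived J k) \<and>
          \<lbrace>x, y\<rbrace> \<in> I + alg_product (derived J k) (derived J k)"
        using * by (simp add: set_plus_intro alg_productI)
    qed
    then show ?case
      using alg_product_mono[OF Suc Suc] by (simp add: square_eq_alg_product)
  qed simp
  from this[of n] have "derived (I + J) n \<subseteq> I" by (simp add: n)
  then have "derived (I + J) (n + m) \<subseteq> {0}" using derived_mono[of _ I m] m by (simp add: derived_add)
  moreover have "0 \<in> derived (I + J) (n + m)"
    by (intro subspace_0 idealD derived_ideal ideal_plus assms)
  ultimately show ?thesis by (auto simp: solvable_def)
qed

lemma radical_greatest:
  "ideal radical" "solvable radical" "ideal I \<Longrightarrow> solvable I \<Longrightarrow> I \<subseteq> radical"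
proof -
  have 1: "ideal {0} \<and> solvable {0}" by (auto simp: ideal_0 solvable_def intro: exI[of _ 0])
  have 2: "subspace S" if "ideal S \<and> solvable S" for S using that idealD(1) by simp
  have 3: "ideal (S + T) \<and> solvable (S + T)" if "ideal S \<and> solvable S" "ideal T \<and> solvable T" for S T
    using that by (simp add: ideal_plus solvable_plus)
  note * = greatest_subspace_exists[of "\<lambda>I. ideal I \<and> solvable I", OF 1 2 3, folded radical_def]
  show "ideal radical" "solvable radical" "ideal I \<Longrightarrow> solvable I \<Longrightarrow> I \<subseteq> radical"
    using *(1) *(2)[of I] by simp_all
qed

lemma zero_ideal_solvable: "zero_ideal I \<Longrightarrow> solvable I"
  unfolding zero_ideal_def solvable_def by (rule exI[of _ 1]) simp

lemma subspace_sum_sets: "(\<And>i. i \<in> A \<Longrightarrow> subspace (f i)) \<Longrightarrow> subspace (\<Sum>i\<in>A. f i)"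
  by (induction A rule: infinite_finite_induct) (simp_all add: subspace_plus)

lemma sum_sets_subset:
  assumes "subspace W"
  shows "(\<And>i. i \<in> A \<Longrightarrow> subspace (f i) \<and> f i \<subseteq> W) \<Longrightarrow> (\<Sum>i\<in>A. f i) \<subseteq> W"
  using assms
  by (induction A rule: infinite_finite_induct)
     (simp_all add: plus_subset_iff subspace_sum_sets subspace_0)

lemma sum_sets_upper:
  assumes "finite A" "j \<in> A" "\<And>i. i \<in> A \<Longrightarrow> subspace (f i)"
  shows "f j \<subseteq> (\<Sum>i\<in>A. f i)"
  using plus_upper(1)[OF assms(3)[OF assms(2)] subspace_sum_sets[of "A - {j}" f]] assms
  by (simp add: sum.remove[of A j])

lemma alg_power_le_1: "n \<le> 1 \<Longrightarrow> alg_power A n = A"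
  by (simp add: alg_power.simps)

lemma alg_power_rec:
  "n > 1 \<Longrightarrow> alg_power A n = (\<Sum>i\<in>{1..<n}. alg_product (alg_power A i) (alg_power A (n - i)))"
  by (subst alg_power.simps) (simp add: alg_product_def)

text \<open>The powers form the least filtration that starts at \<open>A\<close> and is compatible with both
  products. This bounds them without unfolding their recursion.\<close>

lemma alg_power_least:
  assumes W: "\<And>n. subspace (W n)" "A \<subseteq> W 1"
    and mul: "\<And>i j. i \<ge> 1 \<Longrightarrow> j \<ge> 1 \<Longrightarrow> alg_product (W i) (W j) \<subseteq> W (i + j)"
    and "n \<ge> 1"
  shows "alg_power A n \<subseteq> W n"
  using \<open>n \<ge> 1\<close>
proof (induction n rule: less_induct)
  case (less n)
  show ?case
  proof (cases "n = 1")
    case True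
    then show ?thesis using W by (simp add: alg_power_le_1)
  next
    case False
    have "alg_product (alg_power A i) (alg_power A (n - i)) \<subseteq> W n" if "i \<in> {1..<n}" for i
    proof -
      have "alg_product (alg_power A i) (alg_power A (n - i)) \<subseteq> alg_product (W i) (W (n - i))"
        using that by (intro alg_product_mono less.IH) auto
      also have "\<dots> \<subseteq> W (i + (n - i))" using that by (intro mul) auto
      finally show ?thesis using that by simp
    qed
    then have "(\<Sum>i\<in>{1..<n}. alg_product (alg_power A i) (alg_power A (n - i))) \<subseteq> W n"
      using subspace_alg_product by (intro sum_sets_subset W) blast
    then show ?thesis using False less.prems by (simp add: alg_power_rec)
  qed
qed

lemma alg_power_ideal: "ideal A \<Longrightarrow> ideal (alg_power A n)"
proof (induction n rule: less_induct)
  case (less n)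
  show ?case
  proof (cases "n \<le> 1")
    case True
    then show ?thesis using less by (simp add: alg_power_le_1)
  next
    case False
    have "ideal (\<Sum>i\<in>S. alg_product (alg_power A i) (alg_power A (n - i)))" if "S \<subseteq> {1..<n}" for S
      using finite_subset[OF that finite_atLeastLessThan] that
      by (induction S rule: finite_induct)
         (auto intro!: ideal_plus ideal_alg_product less simp: ideal_0)
    then show ?thesis using False by (simp add: alg_power_rec)
  qed
qed

lemma alg_product_power_subset:
  assumes "ideal A" "i \<ge> 1" "j \<ge> 1"
  shows "alg_product (alg_power A i) (alg_power A j) \<subseteq> alg_power A (i + j)"
  using sum_sets_upper[of "{1..<i + j}" i "\<lambda>k. alg_product (alg_power A k) (alg_power A (i + j - k))"]
    assms by (simp add: alg_power_rec subspace_alg_product)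

text \<open>Powers with the whole algebra in place of the zeroth power: this makes the inclusion
  \<open>A\<^sup>i A\<^sup>j \<subseteq> A\<^sup>i\<^sup>+\<^sup>j\<close> hold for all exponents.\<close>

definition power0 :: "'p set \<Rightarrow> nat \<Rightarrow> 'p set" where
  "power0 A n = (if n = 0 then UNIV else alg_power A n)"

lemma power0_ideal: "ideal A \<Longrightarrow> ideal (power0 A n)"
  by (simp add: power0_def alg_power_ideal ideal_UNIV)

lemma alg_product_power0_subset:
  assumes "ideal A"
  shows "alg_product (power0 A i) (power0 A j) \<subseteq> power0 A (i + j)"
  using assms alg_product_power_subset[of A i j] alg_product_ideal_subset[OF alg_power_ideal]
  by (auto simp: power0_def)

lemma alg_power_antimono:
  assumes "ideal A" "m \<le> n" "m \<ge> 1"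
  shows "alg_power A n \<subseteq> alg_power A m"
proof -
  \<comment> \<open>The intersections form a compatible filtration because each \<open>k \<le> i + j\<close> splits into parts
    of size at most \<open>i\<close> and at most \<open>j\<close>.\<close>
  define W where "W n = (\<Inter>m\<in>{..n}. power0 A m)" for n
  have "alg_power A n \<subseteq> W n"
  proof (rule alg_power_least)
    show "subspace (W n)" for n
      unfolding W_def by (rule subspace_Int, rule idealD(1), rule power0_ideal[OF assms(1)])
    show "A \<subseteq> W 1" by (auto simp: W_def power0_def alg_power_le_1)
    show "alg_product (W i) (W j) \<subseteq> W (i + j)" for i j
    proof -
      have "alg_product (W i) (W j) \<subseteq> power0 A k" if "k \<le> i + j" for k
      proof -
        have "alg_product (W i) (W j) \<subseteq> alg_product (power0 A (min i k)) (power0 A (k - min i k))"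
          unfolding W_def using that by (intro alg_product_mono) auto
        also have "\<dots> \<subseteq> power0 A (min i k + (k - min i k))"
          by (rule alg_product_power0_subset[OF assms(1)])
        finally show ?thesis by simp
      qed
      then show ?thesis unfolding W_def by blast
    qed
  qed (use assms in auto)
  then show ?thesis using assms by (auto simp: W_def power0_def)
qed

text \<open>A product of \<open>n\<close> elements of \<open>I + J\<close> expands into products with \<open>k\<close> factors from \<open>I\<close> and
  \<open>n - k\<close> from \<open>J\<close>, and these lie in \<open>I\<^sup>k \<inter> J\<^sup>n\<^sup>-\<^sup>k\<close>.\<close>

lemma nilpotent_plus:
  assumes I: "ideal I" "nilpotent I" and J: "ideal J" "nilpotent J"
  shows "nilpotent (I + J)"
proof -
  obtain a b where a: "a \<ge> 1" "alg_power I a = {0}" and b: "b \<ge> 1" "alg_power J b = {0}"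
    using assms by (auto simp: nilpotent_def)
  define G where "G n = (\<Union>k\<in>{..n}. power0 I k \<inter> power0 J (n - k))" for n
  have prod_G: "x \<cdot> y \<in> G (i + j) \<and> \<lbrace>x, y\<rbrace> \<in> G (i + j)" if "x \<in> G i" "y \<in> G j" for x y i j
  proof -
    obtain k l where *: "k \<le> i" "l \<le> j" "x \<in> power0 I k" "x \<in> power0 J (i - k)"
      "y \<in> power0 I l" "y \<in> power0 J (j - l)" using \<open>x \<in> G i\<close> \<open>y \<in> G j\<close> by (auto simp: G_def)
    then have "i - k + (j - l) = i + j - (k + l)" by simp
    then have "alg_product (power0 J (i - k)) (power0 J (j - l)) \<subseteq> power0 J (i + j - (k + l))"
      using alg_product_power0_subset[OF J(1), of "i - k" "j - l"] by simp
    then have "x \<cdot> y \<in> power0 I (k + l) \<inter> power0 J (i + j - (k + l))"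
      "\<lbrace>x, y\<rbrace> \<in> power0 I (k + l) \<inter> power0 J (i + j - (k + l))"
      using alg_product_power0_subset[OF I(1), of k l] alg_productI[OF *(3,5)] alg_productI[OF *(4,6)]
      by auto
    moreover have "k + l \<in> {..i + j}" using * by simp
    ultimately show ?thesis unfolding G_def by blast
  qed
  have "alg_power (I + J) (a + b) \<subseteq> span (G (a + b))"
  proof (rule alg_power_least[where W = "\<lambda>n. span (G n)"])
    have "I \<subseteq> G 1" "J \<subseteq> G 1"
      by (auto simp: G_def power0_def alg_power_le_1 atMost_Suc)
    then show "I + J \<subseteq> span (G 1)"
      using plus_subset_iff[of I J "span (G 1)"] span_superset[of "G 1"] I J idealD(1) by auto
    show "alg_product (span (G i)) (span (G j)) \<subseteq> span (G (i + j))" for i j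
      using prod_G by (intro alg_product_span_subset) (auto intro: span_base)
  qed (use a in auto)
  moreover have "G (a + b) \<subseteq> {0}"
  proof
    fix x assume "x \<in> G (a + b)"
    then obtain k where k: "x \<in> power0 I k" "x \<in> power0 J (a + b - k)" by (auto simp: G_def)
    show "x \<in> {0}"
    proof (cases "k \<ge> a")
      case True
      then have "power0 I k \<subseteq> {0}"
        using a alg_power_antimono[OF I(1), of a k] by (simp add: power0_def)
      then show ?thesis using k(1) by blast
    next
      case False
      then have "power0 J (a + b - k) \<subseteq> {0}"
        using b alg_power_antimono[OF J(1), of b "a + b - k"] by (simp add: power0_def)
      then show ?thesis using k(2) by blast
    qed
  qed
  ultimately have "alg_power (I + J) (a + b) \<subseteq> {0}"
    using span_minimal[of "G (a + b)" "{0}"] by auto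
  moreover have "0 \<in> alg_power (I + J) (a + b)"
    using I J by (intro subspace_0 idealD alg_power_ideal ideal_plus)
  ultimately show ?thesis using a by (auto simp: nilpotent_def intro!: exI[of _ "a + b"])
qed

lemma nilradical_greatest:
  "ideal nilradical" "nilpotent nilradical" "ideal I \<Longrightarrow> nilpotent I \<Longrightarrow> I \<subseteq> nilradical"
proof -
  have 1: "ideal {0} \<and> nilpotent {0}"
    by (auto simp: ideal_0 nilpotent_def alg_power_le_1 intro: exI[of _ 1])
  have 2: "subspace S" if "ideal S \<and> nilpotent S" for S using that idealD(1) by simp
  have 3: "ideal (S + T) \<and> nilpotent (S + T)" if "ideal S \<and> nilpotent S" "ideal T \<and> nilpotent T" for S T
    using that by (simp add: ideal_plus nilpotent_plus)
  note * = greatest_subspace_exists[of "\<lambda>I. ideal I \<and> nilpotent I", OF 1 2 3, folded nilradical_def]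
  show "ideal nilradical" "nilpotent nilradical" "ideal I \<Longrightarrow> nilpotent I \<Longrightarrow> I \<subseteq> nilradical"
    using *(1) *(2)[of I] by simp_all
qed

lemma alg_power_2: "alg_power A 2 = square A"
proof -
  have "{Suc 0..<2} = {1}" by auto
  then show ?thesis by (simp add: alg_power_rec alg_power_le_1 square_eq_alg_product)
qed

lemma zero_ideal_nilpotent: "zero_ideal I \<Longrightarrow> nilpotent I"
  unfolding zero_ideal_def nilpotent_def by (rule exI[of _ 2]) (simp add: alg_power_2)

section \<open>Supplements of ideals and the Frattini ideal\<close>

lemma subspace_frattini_subalgebra: "subspace frattini_subalgebra"
  unfolding frattini_subalgebra_def
  by (intro subspace_Inter) (auto simp: maximal_subalgebra_def subalgebra_def)

lemma frattini_ideal_greatest: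
  "ideal frattini_ideal" "frattini_ideal \<subseteq> frattini_subalgebra"
  "ideal I \<Longrightarrow> I \<subseteq> frattini_subalgebra \<Longrightarrow> I \<subseteq> frattini_ideal"
proof -
  have 1: "ideal {0} \<and> {0} \<subseteq> frattini_subalgebra"
    using subspace_0[OF subspace_frattini_subalgebra] by (simp add: ideal_0)
  have 2: "subspace S" if "ideal S \<and> S \<subseteq> frattini_subalgebra" for S
    using that idealD(1) by simp
  have 3: "ideal (S + T) \<and> S + T \<subseteq> frattini_subalgebra"
    if "ideal S \<and> S \<subseteq> frattini_subalgebra" "ideal T \<and> T \<subseteq> frattini_subalgebra" for S T
    using that by (simp add: ideal_plus plus_subset_iff idealD(1) subspace_frattini_subalgebra)
  note * = greatest_subspace_exists[of "\<lambda>I. ideal I \<and> I \<subseteq> frattini_subalgebra",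
      OF 1 2 3, folded frattini_ideal_def]
  show "ideal frattini_ideal" "frattini_ideal \<subseteq> frattini_subalgebra"
    "ideal I \<Longrightarrow> I \<subseteq> frattini_subalgebra \<Longrightarrow> I \<subseteq> frattini_ideal"
    using *(1) *(2)[of I] by simp_all
qed

text \<open>An ideal is supplemented by every maximal subalgebra that does not contain it. An ideal inside
  all maximal subalgebras is supplemented by no proper subalgebra \<open>M\<close>, because a maximal subalgebra
  above \<open>M\<close> would contain both.\<close>

lemma phi_free_iff_supplemented:
  "phi_free \<longleftrightarrow>
    (\<forall>J. ideal J \<and> J \<noteq> {0} \<longrightarrow> (\<exists>M. subalgebra M \<and> M \<noteq> UNIV \<and> J + M = UNIV))"
proof
  assume free: "phi_free"
  show "\<forall>J. ideal J \<and> J \<noteq> {0} \<longrightarrow> (\<exists>M. subalgebra M \<and> M \<noteq> UNIV \<and> J + M = UNIV)"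
  proof (intro allI impI)
    fix J assume J: "ideal J \<and> J \<noteq> {0}"
    have "\<not> J \<subseteq> frattini_subalgebra"
      using frattini_ideal_greatest(3)[of J] J free subspace_0[OF idealD(1), of J]
      by (auto simp: phi_free_def)
    then obtain M where M: "maximal_subalgebra M" "\<not> J \<subseteq> M"
      unfolding frattini_subalgebra_def by blast
    have "subalgebra M" "M \<noteq> UNIV" using M(1) by (simp_all add: maximal_subalgebra_def)
    have up: "J \<subseteq> J + M" "M \<subseteq> J + M"
      using plus_upper[of J M] J \<open>subalgebra M\<close> idealD(1) by (simp_all add: subalgebra_def)
    have "subalgebra (J + M)" using J \<open>subalgebra M\<close> by (simp add: subalgebra_ideal_plus)
    then have "J + M = M \<or> J + M = UNIV" using M(1) up(2) by (simp add: maximal_subalgebra_def)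
    then have "J + M = UNIV" using M(2) up(1) by auto
    then show "\<exists>M. subalgebra M \<and> M \<noteq> UNIV \<and> J + M = UNIV"
      using \<open>subalgebra M\<close> \<open>M \<noteq> UNIV\<close> by blast
  qed
next
  assume supp: "\<forall>J. ideal J \<and> J \<noteq> {0} \<longrightarrow> (\<exists>M. subalgebra M \<and> M \<noteq> UNIV \<and> J + M = UNIV)"
  show "phi_free"
  proof (rule ccontr)
    assume "\<not> phi_free"
    then obtain M where M: "subalgebra M" "M \<noteq> UNIV" "frattini_ideal + M = UNIV"
      using supp frattini_ideal_greatest(1) by (auto simp: phi_free_def)
    show False
    proof (rule maximal_subspace_exists[of "\<lambda>S. subalgebra S \<and> S \<noteq> UNIV" M])
      fix K assume K: "subalgebra K \<and> K \<noteq> UNIV" "M \<subseteq> K"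
        "\<And>T. subalgebra T \<and> T \<noteq> UNIV \<Longrightarrow> K \<subseteq> T \<Longrightarrow> T = K"
      have "maximal_subalgebra K" unfolding maximal_subalgebra_def using K(1,3) by metis
      then have "frattini_subalgebra \<subseteq> K" by (auto simp: frattini_subalgebra_def)
      then have "frattini_ideal \<subseteq> K" using frattini_ideal_greatest(2) by simp
      then have "frattini_ideal + M \<subseteq> K"
        using K(1,2) M(1) idealD(1)[OF frattini_ideal_greatest(1)]
        by (simp add: plus_subset_iff subalgebra_def)
      then show False using M(3) K(1) by auto
    qed (use M in \<open>auto simp: subalgebra_def\<close>)
  qed
qed

text \<open>One inclusion of Dedekind's modular law, which carries a supplement of \<open>B\<close> over to subspaces
  above \<open>B\<close>.\<close>

lemma modular_subset:
  assumes "subspace A" "B \<subseteq> A" "B + M = UNIV"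
  shows "A \<subseteq> (M \<inter> A) + B"
proof
  fix x assume "x \<in> A"
  have "x \<in> B + M" using assms(3) by simp
  then obtain b m where bm: "x = b + m" "b \<in> B" "m \<in> M" by (rule set_plus_elim)
  then have "m = x - b" by simp
  then have "m \<in> A" using \<open>x \<in> A\<close> bm(2) assms(1,2) by (auto intro: subspace_diff)
  then have "m + b \<in> (M \<inter> A) + B" using bm by (intro set_plus_intro) auto
  then show "x \<in> (M \<inter> A) + B" by (simp add: bm(1) add.commute)
qed

lemma product_in_span:
  "f \<in> F \<Longrightarrow> x \<in> A \<Longrightarrow> y \<in> A \<Longrightarrow> f x y \<in> span {f x y | f x y. f \<in> F \<and> x \<in> A \<and> y \<in> A}"
  by (rule span_base) blast

text \<open>A nilpotent algebra \<open>A\<close> is generated by any subalgebra \<open>S\<close> that covers \<open>A\<close> modulo products.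
  The filtration \<open>W\<close> measures nilpotency with respect to a set \<open>F\<close> of products, so that the
  statement applies to a Poisson algebra as well as to its associative product alone.\<close>

lemma generated_modulo_filtration:
  assumes F: "\<And>f x. f \<in> F \<Longrightarrow> lin (f x)" "\<And>f y. f \<in> F \<Longrightarrow> lin (\<lambda>x. f x y)"
    and S: "subspace S" "S \<subseteq> A" "\<And>f x y. f \<in> F \<Longrightarrow> x \<in> S \<Longrightarrow> y \<in> S \<Longrightarrow> f x y \<in> S"
    and gen: "A \<subseteq> S + span {f x y | f x y. f \<in> F \<and> x \<in> A \<and> y \<in> A}"
    and W: "\<And>n. subspace (W n)" "A \<subseteq> W 0"
      "\<And>f x y n. f \<in> F \<Longrightarrow> x \<in> A \<Longrightarrow> y \<in> W n \<Longrightarrow> f x y \<in> W (Suc n) \<and> f y x \<in> W (Suc n)"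
  shows "A \<subseteq> S + W n"
proof (induction n)
  case 0
  show ?case using plus_upper(2)[OF S(1) W(1)[of 0]] W(2) by blast
next
  case (Suc n)
  have sub: "subspace (S + W (Suc n))" by (intro subspace_plus S W)
  have "f x y \<in> S + W (Suc n)" if f: "f \<in> F" and xy: "x \<in> A" "y \<in> A" for f x y
  proof -
    obtain s a t b where *: "x = s + a" "s \<in> S" "a \<in> W n" "y = t + b" "t \<in> S" "b \<in> W n"
      using Suc xy by (meson set_plus_elim subsetD)
    have "f x y = f s t + (f s b + f a y)"
      by (simp add: *(1,4) lin_simps(1)[OF F(1)[OF f]] lin_simps(1)[OF F(2)[OF f]] add.assoc)
    moreover have "f s b + f a y \<in> W (Suc n)"
      using W(3)[OF f, of s b n] W(3)[OF f, of y a n] * xy S(2) by (intro subspace_add[OF W(1)]) auto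
    ultimately show ?thesis using S(3)[OF f *(2,5)] by (simp add: set_plus_intro)
  qed
  then have "span {f x y | f x y. f \<in> F \<and> x \<in> A \<and> y \<in> A} \<subseteq> S + W (Suc n)"
    by (intro span_minimal sub) blast
  moreover have "S \<subseteq> S + W (Suc n)" by (rule plus_upper(1)[OF S(1) W(1)])
  ultimately have "S + span {f x y | f x y. f \<in> F \<and> x \<in> A \<and> y \<in> A} \<subseteq> S + W (Suc n)"
    by (simp add: plus_subset_iff S(1) sub)
  then show ?case using gen by blast
qed

text \<open>Hence an ideal \<open>B\<close> spanned by products in such an \<open>A\<close> lies in every subalgebra \<open>M\<close> with
  \<open>B + M = P\<close>. So \<open>M = P\<close>, which \<open>\<phi>\<close>-freeness forbids unless \<open>B = 0\<close>.\<close>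

lemma phi_free_product_ideal_trivial:
  assumes phi_free "F \<subseteq> {mult, brk}" "ideal A" and B: "ideal B" "B \<subseteq> A"
    and prod: "B \<subseteq> span {f x y | f x y. f \<in> F \<and> x \<in> A \<and> y \<in> A}"
    and W: "\<And>n. subspace (W n)" "A \<subseteq> W 0" "W m = {0}"
      "\<And>f x y n. f \<in> F \<Longrightarrow> x \<in> A \<Longrightarrow> y \<in> W n \<Longrightarrow> f x y \<in> W (Suc n) \<and> f y x \<in> W (Suc n)"
  shows "B = {0}"
proof (rule ccontr)
  assume "B \<noteq> {0}"
  then obtain M where M: "subalgebra M" "M \<noteq> UNIV" "B + M = UNIV"
    using assms(1) B(1) unfolding phi_free_iff_supplemented by blast
  have lin: "lin (f x)" "lin (\<lambda>x. f x y)" if "f \<in> F" for f x y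
    using that assms(2) mult_linear_left mult_linear_right brk_linear_left brk_linear_right by auto
  have S: "subspace (M \<inter> A)" using M(1) idealD(1)[OF assms(3)] by (simp add: subalgebra_def subspace_inter)
  have closed: "f x y \<in> M \<inter> A" if "f \<in> F" "x \<in> M \<inter> A" "y \<in> M \<inter> A" for f x y
    using that assms(2) M(1) idealD(2,4)[OF assms(3)] by (auto simp: subalgebra_def)
  have "A \<subseteq> (M \<inter> A) + B" by (rule modular_subset[OF idealD(1)[OF assms(3)] B(2) M(3)])
  also have "\<dots> \<subseteq> (M \<inter> A) + span {f x y | f x y. f \<in> F \<and> x \<in> A \<and> y \<in> A}"
    by (rule set_plus_mono2[OF order.refl prod])
  finally have gen: "A \<subseteq> (M \<inter> A) + span {f x y | f x y. f \<in> F \<and> x \<in> A \<and> y \<in> A}" .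
  have "A \<subseteq> (M \<inter> A) + W m"
    by (rule generated_modulo_filtration[of F "M \<inter> A" A W])
       (rule lin S Int_lower2 closed gen W; assumption)+
  then have "B \<subseteq> M" using W(3) B(2) by auto
  then have "B + M \<subseteq> M" using M(1) idealD(1)[OF B(1)] by (simp add: plus_subset_iff subalgebra_def)
  then show False using M by auto
qed

lemma phi_free_nilradical_zero_ideal:
  assumes phi_free
  shows "zero_ideal nilradical"
proof -
  let ?N = nilradical
  have N: "ideal ?N" by (rule nilradical_greatest)
  obtain m where m: "m \<ge> 1" "alg_power ?N m = {0}"
    using nilradical_greatest(2) by (auto simp: nilpotent_def)
  have "square ?N = {0}"
  proof (rule phi_free_product_ideal_trivial[OF assms, where F = "{mult, brk}" and A = ?N
        and W = "\<lambda>n. alg_power ?N (Suc n)" and m = "m - 1"])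
    show "ideal (square ?N)" "square ?N \<subseteq> ?N"
      using N by (simp_all add: square_eq_alg_product ideal_alg_product alg_product_ideal_subset)
    show "square ?N \<subseteq> span {f x y |f x y. f \<in> {mult, brk} \<and> x \<in> ?N \<and> y \<in> ?N}"
      unfolding square_eq_alg_product alg_product_subset_iff[OF subspace_span]
      by (intro ballI conjI product_in_span) simp_all
    show "alg_power ?N (Suc (m - 1)) = {0}" using m by simp
    show "f x y \<in> alg_power ?N (Suc (Suc n)) \<and> f y x \<in> alg_power ?N (Suc (Suc n))"
      if "f \<in> {mult, brk}" "x \<in> ?N" "y \<in> alg_power ?N (Suc n)" for f x y n
    proof -
      have "alg_product ?N (alg_power ?N (Suc n)) \<subseteq> alg_power ?N (Suc (Suc n))"
        "alg_product (alg_power ?N (Suc n)) ?N \<subseteq> alg_power ?N (Suc (Suc n))"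
        using alg_product_power_subset[OF N, of 1 "Suc n"] alg_product_power_subset[OF N, of "Suc n" 1]
        by (simp_all add: alg_power_le_1)
      then show ?thesis
        using that(1) alg_productI[OF that(2,3)] alg_productI[OF that(3,2)] by auto
    qed
  qed (use N alg_power_ideal idealD(1) in \<open>auto simp: alg_power_le_1\<close>)
  then show ?thesis using N by (simp add: zero_ideal_def)
qed

primrec mult_power :: "'p set \<Rightarrow> nat \<Rightarrow> 'p set" where
  "mult_power A 0 = A"
| "mult_power A (Suc n) = mult_space A (mult_power A n)"

lemma mult_space_mono: "S \<subseteq> S' \<Longrightarrow> T \<subseteq> T' \<Longrightarrow> mult_space S T \<subseteq> mult_space S' T'"
  by (subst mult_space_subset_iff) (auto intro: mult_spaceI subspace_mult_space)

lemma mult_power_split: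
  "mult_power A (Suc (m + n)) \<subseteq> mult_space (mult_power A m) (mult_power A n)"
proof (induction m)
  case 0
  show ?case by simp
next
  case (Suc m)
  let ?W = "mult_space (mult_power A (Suc m)) (mult_power A n)"
  have "mult_space (mult_power A m) (mult_power A n) \<subseteq> {w. x \<cdot> w \<in> ?W}" if "x \<in> A" for x
  proof (subst mult_space_subset_iff)
    show "subspace {w. x \<cdot> w \<in> ?W}"
      by (rule subspace_preimage[OF mult_linear_right subspace_mult_space])
    show "\<forall>y\<in>mult_power A m. \<forall>z\<in>mult_power A n. y \<cdot> z \<in> {w. x \<cdot> w \<in> ?W}"
      using that by (auto simp: mult_assoc[symmetric] intro!: mult_spaceI)
  qed
  then have "mult_space A (mult_space (mult_power A m) (mult_power A n)) \<subseteq> ?W"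
    by (subst mult_space_subset_iff[OF subspace_mult_space]) blast
  then show ?case
    using mult_space_mono[OF order.refl Suc, of A] by simp
qed

text \<open>A commutative associative algebra that is solvable is nilpotent: the \<open>m\<close>-th derived algebra
  contains the product of \<open>2\<^sup>m\<close> copies of the algebra.\<close>

lemma mult_power_subset_derived: "\<exists>k. mult_power A k \<subseteq> derived A m"
proof (induction m)
  case 0
  show ?case by (auto intro: exI[of _ 0])
next
  case (Suc m)
  then obtain k where k: "mult_power A k \<subseteq> derived A m" by blast
  have "mult_power A (Suc (k + k)) \<subseteq> mult_space (derived A m) (derived A m)"
    using mult_power_split[of A k k] mult_space_mono[OF k k] by blast
  also have "\<dots> \<subseteq> derived A (Suc m)"
    by (subst mult_space_subset_iff) (auto simp: square_eq_alg_product alg_productI subspace_alg_product)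
  finally show ?case by blast
qed

lemma phi_free_radical_mult:
  assumes phi_free
  shows "mult_space radical radical = {0}"
proof -
  let ?R = radical
  have R: "ideal ?R" by (rule radical_greatest)
  obtain m where m: "derived ?R m = {0}"
    using radical_greatest(2) by (auto simp: solvable_def)
  obtain k where k: "mult_power ?R k \<subseteq> {0}" using mult_power_subset_derived[of ?R m] m by auto
  have ideal: "ideal (mult_power ?R n)" for n
    by (induction n) (simp_all add: R ideal_mult_space)
  show ?thesis
  proof (rule phi_free_product_ideal_trivial[OF assms, where F = "{mult}" and A = ?R
        and W = "mult_power ?R" and m = k])
    show "mult_space ?R ?R \<subseteq> ?R"
      using idealD(1,2)[OF R] by (subst mult_space_subset_iff) auto
    show "mult_space ?R ?R \<subseteq> span {f x y |f x y. f \<in> {mult} \<and> x \<in> ?R \<and> y \<in> ?R}"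
      unfolding mult_space_subset_iff[OF subspace_span]
      by (intro ballI product_in_span) simp_all
    show "mult_power ?R k = {0}" using k subspace_0[OF idealD(1)[OF ideal]] by blast
    show "f x y \<in> mult_power ?R (Suc n) \<and> f y x \<in> mult_power ?R (Suc n)"
      if "f \<in> {mult}" "x \<in> ?R" "y \<in> mult_power ?R n" for f x y n
      using that mult_spaceI[of x ?R y "mult_power ?R n"] by (simp add: mult_commute[of y])
  qed (use R ideal ideal_mult_space idealD(1) in auto)
qed

section \<open>Complements of zero ideals\<close>

text \<open>A subalgebra \<open>U\<close> that is minimal subject to \<open>I + U = P\<close> is a complement: since \<open>I\<close> has zero
  products, \<open>I \<inter> U\<close> is an ideal, and a supplement of that ideal would cut \<open>U\<close> down further.\<close>

lemma phi_free_zero_ideal_complement: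
  assumes phi_free and I: "zero_ideal I"
  obtains U where "subalgebra U" "direct_decomposition I U"
proof (rule minimal_subspace_exists[of "\<lambda>U. subalgebra U \<and> I + U = UNIV" UNIV])
  have [simp]: "ideal I" "subspace I" using zero_idealD(1)[OF I] idealD(1) by auto
  have "I + UNIV = UNIV" using plus_upper(2)[of I UNIV] by auto
  then show "subalgebra UNIV \<and> I + UNIV = UNIV" by (simp add: subalgebra_def)
  fix U assume U: "subalgebra U \<and> I + U = UNIV"
    and min: "\<And>T. subalgebra T \<and> I + T = UNIV \<Longrightarrow> T \<subseteq> U \<Longrightarrow> T = U"
  define K where "K = I \<inter> U"
  have "ideal K"
  proof (rule idealI)
    show "subspace K" using U by (simp add: K_def subalgebra_def subspace_inter)
    fix x p assume x: "x \<in> K"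
    have "p \<in> I + U" using U by simp
    then obtain i u where p: "p = i + u" "i \<in> I" "u \<in> U" by (rule set_plus_elim)
    have "x \<cdot> p = x \<cdot> u" "\<lbrace>x, p\<rbrace> = \<lbrace>x, u\<rbrace>"
      using zero_idealD(2,3)[OF I, of x i] x p by (simp_all add: K_def mult_simps brk_simps)
    then show "x \<cdot> p \<in> K" "\<lbrace>x, p\<rbrace> \<in> K"
      using x p U idealD(2,4)[OF \<open>ideal I\<close>] by (simp_all add: K_def subalgebra_def)
  qed
  have "K = {0}"
  proof (rule ccontr)
    assume "K \<noteq> {0}"
    then obtain M where M: "subalgebra M" "M \<noteq> UNIV" "K + M = UNIV"
      using assms(1) \<open>ideal K\<close> unfolding phi_free_iff_supplemented by blast
    have sub: "subalgebra (M \<inter> U)" using M U by (simp add: subalgebra_Int)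
    have up: "I \<subseteq> I + (M \<inter> U)" "M \<inter> U \<subseteq> I + (M \<inter> U)" and sp: "subspace (I + (M \<inter> U))"
      using plus_upper[of I "M \<inter> U"] sub by (simp_all add: subalgebra_def subspace_plus)
    have "U \<subseteq> (M \<inter> U) + K"
      using U M(3) by (intro modular_subset) (auto simp: K_def subalgebra_def)
    also have "\<dots> \<subseteq> I + (M \<inter> U)"
      using sub up sp \<open>ideal K\<close> by (subst plus_subset_iff) (auto simp: K_def subalgebra_def idealD(1))
    finally have "I + U \<subseteq> I + (M \<inter> U)"
      using up(1) sp U by (subst plus_subset_iff) (auto simp: subalgebra_def)
    then have "M \<inter> U = U" using U sub by (intro min) auto
    then have "K + M \<subseteq> M" using M(1) idealD(1)[OF \<open>ideal K\<close>]
      by (subst plus_subset_iff) (auto simp: K_def subalgebra_def)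
    then show False using M by auto
  qed
  then show thesis using that[of U] U by (simp add: direct_decomposition_def K_def)
qed (auto simp: subalgebra_def)

text \<open>A complement \<open>V\<close> of \<open>I\<close> in the whole algebra meets \<open>N\<close> in an ideal: \<open>V \<inter> N\<close> is stable under
  \<open>V\<close>, and \<open>I\<close> annihilates it since \<open>N\<close> has zero products.\<close>

lemma phi_free_ideal_complement:
  assumes phi_free and N: "zero_ideal N" and I: "ideal I" "I \<subseteq> N"
  obtains C where "ideal C" "C \<subseteq> N" "I \<inter> C = {0}" "I + C = N"
proof -
  obtain V where "subalgebra V" "direct_decomposition I V"
    by (rule phi_free_zero_ideal_complement[OF assms(1) zero_ideal_subset[OF N I]])
  then have V: "subalgebra V" "I + V = UNIV" "I \<inter> V = {0}"
    by (simp_all add: direct_decomposition_def)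
  have [simp]: "ideal N" using N by (rule zero_idealD)
  define C where "C = V \<inter> N"
  have "ideal C"
  proof (rule idealI)
    show "subspace C" using V(1) idealD(1)[of N] by (simp add: C_def subalgebra_def subspace_inter)
    fix x p assume x: "x \<in> C"
    have "p \<in> I + V" using V by simp
    then obtain i v where p: "p = i + v" "i \<in> I" "v \<in> V" by (rule set_plus_elim)
    have "x \<cdot> p = x \<cdot> v" "\<lbrace>x, p\<rbrace> = \<lbrace>x, v\<rbrace>"
      using zero_idealD(2,3)[OF N, of x i] x p I(2) by (auto simp: C_def mult_simps brk_simps)
    then show "x \<cdot> p \<in> C" "\<lbrace>x, p\<rbrace> \<in> C"
      using x p V(1) idealD(2,4)[of N] by (simp_all add: C_def subalgebra_def)
  qed
  moreover have "I + C = N"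
  proof
    show "I + C \<subseteq> N"
      using I \<open>ideal C\<close> by (subst plus_subset_iff) (auto simp: C_def intro: idealD(1))
    show "N \<subseteq> I + C"
      using modular_subset[OF idealD(1)[of N] I(2) V(2)] by (simp add: C_def add.commute)
  qed
  moreover have "C \<subseteq> N" "I \<inter> C = {0}" using V(3) I(2) by (auto simp: C_def)
  ultimately show ?thesis by (intro that)
qed

lemma minimal_zero_ideal_subset_zsoc: "minimal_ideal I \<Longrightarrow> zero_ideal I \<Longrightarrow> I \<subseteq> zsoc"
  unfolding zsoc_def by (rule order.trans[OF Union_upper span_superset]) simp

lemma zsoc_least:
  assumes "subspace W" "\<And>I. minimal_ideal I \<Longrightarrow> zero_ideal I \<Longrightarrow> I \<subseteq> W"
  shows "zsoc \<subseteq> W"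
  unfolding zsoc_def using assms by (intro span_minimal) auto

lemma subspace_zsoc: "subspace zsoc"
  by (simp add: zsoc_def)

lemma ideal_zsoc: "ideal zsoc"
proof (rule idealI)
  show sub: "subspace zsoc" by (rule subspace_zsoc)
  fix x y assume x: "x \<in> zsoc"
  have *: "x \<cdot> y \<in> zsoc" "\<lbrace>x, y\<rbrace> \<in> zsoc" if "minimal_ideal I" "zero_ideal I" "x \<in> I" for I x
    using minimal_zero_ideal_subset_zsoc[OF that(1,2)] idealD(2,4)[OF zero_idealD(1)[OF that(2)] that(3)]
    by blast+
  have "zsoc \<subseteq> {x. x \<cdot> y \<in> zsoc}"
    by (intro zsoc_least subspace_preimage[OF mult_linear_left sub]) (use * in blast)
  moreover have "zsoc \<subseteq> {x. \<lbrace>x, y\<rbrace> \<in> zsoc}"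
    by (intro zsoc_least subspace_preimage[OF brk_linear_left sub]) (use * in blast)
  ultimately show "x \<cdot> y \<in> zsoc" "\<lbrace>x, y\<rbrace> \<in> zsoc" using x by blast+
qed

text \<open>An ideal complement of the zero socle in \<open>N\<close> contains no minimal ideal, since all minimal
  ideals inside \<open>N\<close> are zero ideals and so belong to the zero socle.\<close>

lemma phi_free_nilradical_eq_zsoc:
  assumes phi_free
  shows "nilradical = zsoc"
proof -
  let ?N = nilradical
  have N: "zero_ideal ?N" by (rule phi_free_nilradical_zero_ideal[OF assms])
  have "zsoc \<subseteq> ?N"
    using nilradical_greatest(3) zero_ideal_nilpotent zero_idealD(1)
    by (intro zsoc_least idealD(1)[OF nilradical_greatest(1)]) auto
  then obtain C where C: "ideal C" "C \<subseteq> ?N" "zsoc \<inter> C = {0}" "zsoc + C = ?N"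
    by (rule phi_free_ideal_complement[OF assms N ideal_zsoc])
  have "C = {0}"
  proof (rule ccontr)
    assume "C \<noteq> {0}"
    then obtain I where I: "minimal_ideal I" "I \<subseteq> C" by (rule minimal_ideal_exists[OF C(1)])
    then have "zero_ideal I"
      using zero_ideal_subset[OF N, of I] C(2) by (auto simp: minimal_ideal_def)
    then have "I \<subseteq> zsoc \<inter> C" using minimal_zero_ideal_subset_zsoc I by blast
    then show False using C(3) I(1) subspace_0[OF idealD(1), of I] by (auto simp: minimal_ideal_def)
  qed
  then show ?thesis using C(4) by simp
qed

text \<open>The zero socle is completely reducible: an ideal \<open>C\<close> inside it that is maximal subject to
  \<open>I \<inter> C = 0\<close> satisfies \<open>I + C = zsoc\<close>, since a minimal ideal outside \<open>I + C\<close> could be added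
  to \<open>C\<close>.\<close>

lemma zsoc_ideal_complement:
  assumes I: "ideal I" "I \<subseteq> zsoc"
  obtains C where "ideal C" "I \<inter> C = {0}" "I + C = zsoc"
proof (rule maximal_subspace_exists[of "\<lambda>C. ideal C \<and> C \<subseteq> zsoc \<and> I \<inter> C = {0}" "{0}"])
  show "ideal {0} \<and> {0} \<subseteq> zsoc \<and> I \<inter> {0} = {0}"
    using subspace_0[OF idealD(1)[OF I(1)]] subspace_0[OF subspace_zsoc] ideal_0 by auto
  fix C assume C: "ideal C \<and> C \<subseteq> zsoc \<and> I \<inter> C = {0}"
    and max: "\<And>T. ideal T \<and> T \<subseteq> zsoc \<and> I \<inter> T = {0} \<Longrightarrow> C \<subseteq> T \<Longrightarrow> T = C"
  have IC: "ideal (I + C)" using I C by (simp add: ideal_plus)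
  have up: "I \<subseteq> I + C" "C \<subseteq> I + C" using plus_upper[of I C] I C idealD(1) by auto
  have "J \<subseteq> I + C" if J: "minimal_ideal J" "zero_ideal J" for J
  proof (rule ccontr)
    assume not: "\<not> J \<subseteq> I + C"
    have "ideal J" using J(2) by (rule zero_idealD)
    then have "J \<inter> (I + C) = {0} \<or> J \<inter> (I + C) = J"
      using J(1) ideal_Int[OF \<open>ideal J\<close> IC] unfolding minimal_ideal_def by blast
    then have J0: "J \<inter> (I + C) = {0}" using not by blast
    have up': "C \<subseteq> C + J" "J \<subseteq> C + J" using plus_upper[of C J] C \<open>ideal J\<close> idealD(1) by auto
    have "C + J \<subseteq> zsoc"
      using C \<open>ideal J\<close> minimal_zero_ideal_subset_zsoc[OF J]
      by (subst plus_subset_iff) (auto intro: idealD(1) subspace_zsoc)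
    moreover have "I \<inter> (C + J) = {0}"
    proof
      show "{0} \<subseteq> I \<inter> (C + J)"
        using subspace_0[OF idealD(1)] I(1) ideal_plus[of C J] C \<open>ideal J\<close> by auto
      show "I \<inter> (C + J) \<subseteq> {0}"
      proof
        fix x assume x: "x \<in> I \<inter> (C + J)"
        then obtain c j where cj: "x = c + j" "c \<in> C" "j \<in> J" by (auto elim: set_plus_elim)
        have "j = x - c" using cj(1) by simp
        then have "j \<in> I + C" using x cj(2) up by (auto intro!: subspace_diff[OF idealD(1)[OF IC]])
        then have "j = 0" using J0 cj(3) by blast
        then show "x \<in> {0}" using x cj C by auto
      qed
    qed
    ultimately have "C + J = C" using C \<open>ideal J\<close> up'(1) by (intro max) (auto simp: ideal_plus)
    then show False using up' up(2) not by blast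
  qed
  then have "zsoc \<subseteq> I + C" by (intro zsoc_least idealD(1)[OF IC])
  moreover have "I + C \<subseteq> zsoc"
    using I C by (subst plus_subset_iff) (auto intro: idealD(1) subspace_zsoc)
  ultimately show thesis using that[of C] C by simp
qed (auto intro: idealD(1))

section \<open>Supplements of minimal ideals\<close>

lemma subalgebra_null_component_brk: "subalgebra (null_component (brk x))"
  unfolding subalgebra_def
proof (intro conjI ballI)
  show "subspace (null_component (brk x))" by (rule subspace_null_component[OF brk_linear_right])
  fix y z assume yz: "y \<in> null_component (brk x)" "z \<in> null_component (brk x)"
  show "y \<cdot> z \<in> null_component (brk x)"
    by (rule null_component_derivation[of "brk x" mult,
          OF brk_linear_right brk_mult_right mult_simps(10,5) yz])
  show "\<lbrace>y, z\<rbrace> \<in> null_component (brk x)"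
    by (rule null_component_derivation[of "brk x" brk,
          OF brk_linear_right brk_brk brk_simps(10,5) yz])
qed

text \<open>If \<open>x\<^sup>m y = 0\<close>, then \<open>x\<^sup>m\<^sup>+\<^sup>1 \<lbrace>y, z\<rbrace> = 0\<close>, because
  \<open>x \<cdot> \<lbrace>y, z\<rbrace> = \<lbrace>x \<cdot> y, z\<rbrace> - \<lbrace>x, z\<rbrace> \<cdot> y\<close>.\<close>

lemma subalgebra_null_component_mult: "subalgebra (null_component (mult x))"
  unfolding subalgebra_def
proof (intro conjI ballI)
  show "subspace (null_component (mult x))" by (rule subspace_null_component[OF mult_linear_right])
  fix y z assume y: "y \<in> null_component (mult x)"
  have mult: "(mult x ^^ n) (u \<cdot> v) = u \<cdot> (mult x ^^ n) v" for n u v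
    by (induction n) (simp_all, metis mult_assoc mult_commute)
  show "y \<cdot> z \<in> null_component (mult x)"
  proof -
    obtain n where "(mult x ^^ n) y = 0" using y by (auto simp: null_component_def)
    then have "(mult x ^^ n) (z \<cdot> y) = 0" by (simp add: mult mult_simps)
    then show ?thesis by (auto simp: null_component_def mult_commute[of y])
  qed
  have "(mult x ^^ Suc m) \<lbrace>y, z\<rbrace> = 0" if "(mult x ^^ m) y = 0" for m y
    using that
  proof (induction m arbitrary: y)
    case 0
    then show ?case by (simp add: brk_simps mult_simps)
  next
    case (Suc m)
    have "(mult x ^^ m) (x \<cdot> y) = 0" using Suc.prems by (simp add: funpow_swap1)
    then have "(mult x ^^ Suc m) \<lbrace>x \<cdot> y, z\<rbrace> = 0" by (rule Suc.IH)
    moreover have "(mult x ^^ Suc m) (\<lbrace>x, z\<rbrace> \<cdot> y) = 0"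
      unfolding mult using Suc.prems by (simp add: mult_simps)
    moreover have "x \<cdot> \<lbrace>y, z\<rbrace> = \<lbrace>x \<cdot> y, z\<rbrace> - \<lbrace>x, z\<rbrace> \<cdot> y" by (simp add: leibniz)
    ultimately have "(mult x ^^ Suc m) (x \<cdot> \<lbrace>y, z\<rbrace>) = 0"
      by (simp only: lin_simps(2)[OF lin_funpow[OF mult_linear_right]] diff_self)
    then show ?case by (simp only: funpow_Suc_right comp_apply)
  qed
  then show "\<lbrace>y, z\<rbrace> \<in> null_component (mult x)" using y unfolding null_component_def by blast
qed

lemma ideal_plus_null_component:
  assumes "lin f" "subspace I" "\<And>v. f v \<in> I"
  shows "I + null_component f = UNIV"
proof -
  have "v \<in> I + null_component f" for v
  proof -
    obtain n w where n: "n \<ge> 1" "v - (f ^^ n) w \<in> null_component f" by (rule fitting[OF assms(1)])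
    moreover have "(f ^^ n) w \<in> I" using n(1) assms(3) by (cases n) auto
    ultimately have "(f ^^ n) w + (v - (f ^^ n) w) \<in> I + null_component f" by (intro set_plus_intro)
    then show ?thesis by simp
  qed
  then show ?thesis by blast
qed

text \<open>Multiplications commute with each other, and so Engel's theorem applies to them with the zero
  bracket on \<open>L\<close>.\<close>

lemma engel_mult:
  assumes "subspace L" "subspace V" "V \<noteq> {0}"
    and "\<And>x v. x \<in> L \<Longrightarrow> v \<in> V \<Longrightarrow> x \<cdot> v \<in> V"
    and nil: "\<And>x. x \<in> L \<Longrightarrow> null_component (mult x) = UNIV"
  shows "\<exists>v\<in>V - {0}. \<forall>x\<in>L. x \<cdot> v = 0"
proof -
  let ?br = "\<lambda>(x::'p) (y::'p). 0::'p"
  have lin0: "lin (\<lambda>y. 0)" by (auto simp: Vector_Spaces.linear_iff vector_space_axioms)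
  have "nil_action ?br L L {0} ?br"
    unfolding nil_action_def using assms(1) lin0 subspace_0[OF assms(1)]
    by (auto intro!: exI[of _ "1::nat"])
  moreover have "nil_action ?br L V {0} mult"
    unfolding nil_action_def
  proof (intro conjI)
    show "\<forall>x\<in>L. \<forall>y\<in>L. \<forall>v\<in>V. x \<cdot> (y \<cdot> v) = 0 \<cdot> v + y \<cdot> (x \<cdot> v)"
      by (metis mult_assoc mult_commute mult_simps(10) add_0)
    show "\<forall>x\<in>L. \<forall>v\<in>V. \<exists>n. (mult x ^^ n) v \<in> {0}"
      using nil unfolding null_component_def by blast
  qed (use assms mult_linear_left mult_linear_right subspace_0[OF assms(2)] in \<open>auto simp: mult_simps\<close>)
  ultimately show ?thesis
    using engel[of ?br L V "{0}" mult] assms by auto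
qed

lemma engel_brk:
  assumes "subspace L" "\<And>x y. x \<in> L \<Longrightarrow> y \<in> L \<Longrightarrow> \<lbrace>x, y\<rbrace> \<in> L" "subspace V" "V \<noteq> {0}"
    and "\<And>x v. x \<in> L \<Longrightarrow> v \<in> V \<Longrightarrow> \<lbrace>x, v\<rbrace> \<in> V"
    and nil: "\<And>x. x \<in> L \<Longrightarrow> null_component (brk x) = UNIV"
  shows "\<exists>v\<in>V - {0}. \<forall>x\<in>L. \<lbrace>x, v\<rbrace> = 0"
proof -
  have act: "nil_action brk L W {0} brk"
    if "subspace W" "\<And>x v. x \<in> L \<Longrightarrow> v \<in> W \<Longrightarrow> \<lbrace>x, v\<rbrace> \<in> W" for W
    unfolding nil_action_def
  proof (intro conjI)
    show "\<forall>x\<in>L. \<forall>y\<in>L. \<forall>v\<in>W. \<lbrace>x, \<lbrace>y, v\<rbrace>\<rbrace> = \<lbrace>\<lbrace>x, y\<rbrace>, v\<rbrace> + \<lbrace>y, \<lbrace>x, v\<rbrace>\<rbrace>"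
      by (intro ballI brk_brk)
    show "\<forall>x\<in>L. \<forall>v\<in>W. \<exists>n. (brk x ^^ n) v \<in> {0}"
      using nil unfolding null_component_def by blast
  qed (use that brk_linear_left brk_linear_right subspace_0[OF that(1)] in \<open>auto simp: brk_simps\<close>)
  have "\<exists>v\<in>V - {0}. \<forall>x\<in>L. \<lbrace>x, v\<rbrace> \<in> {0}"
    by (rule engel[OF brk_alternating assms(1) act[OF assms(1,2)] act[OF assms(3,5)] assms(4)])
  then show ?thesis by simp
qed

text \<open>If multiplication by some \<open>x \<in> I\<close>, or bracketing with it, is not nilpotent, then its null
  component is a proper subalgebra that supplements \<open>I\<close>, by Fitting's lemma. Otherwise Engel's
  theorem gives nonzero elements of \<open>I\<close> annihilated by \<open>I\<close>, first for the product and then for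
  the bracket; these elements form ideals, and minimality makes \<open>I\<close> a zero ideal.\<close>

lemma minimal_nonzero_product_ideal_supplement:
  assumes I: "minimal_ideal I" and "\<not> zero_ideal I"
  shows "\<exists>M. subalgebra M \<and> M \<noteq> UNIV \<and> I + M = UNIV"
proof (rule ccontr)
  assume "\<not> ?thesis"
  then have no: "M = UNIV" if "subalgebra M" "I + M = UNIV" for M using that by blast
  have "ideal I" "I \<noteq> {0}" using I by (simp_all add: minimal_ideal_def)
  have min: "J = I" if "ideal J" "J \<subseteq> I" "J \<noteq> {0}" for J
    using I that by (auto simp: minimal_ideal_def)
  have sub: "subspace I" by (rule idealD(1)[OF \<open>ideal I\<close>])
  have nil: "null_component (mult x) = UNIV" "null_component (brk x) = UNIV" if "x \<in> I" for x
    by (rule no, rule subalgebra_null_component_mult subalgebra_null_component_brk,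
        rule ideal_plus_null_component, rule mult_linear_right brk_linear_right, rule sub,
        rule idealD(2,4)[OF \<open>ideal I\<close> that])+
  have mult0: "x \<cdot> y = 0" if "x \<in> I" "y \<in> I" for x y
  proof -
    define A where "A = {v \<in> I. \<forall>x\<in>I. x \<cdot> v = 0}"
    have "ideal A"
    proof (rule idealI)
      show "subspace A"
        using sub by (intro subspaceI) (auto simp: A_def mult_simps subspace_0 subspace_add subspace_scale)
      fix v p assume v: "v \<in> A"
      then show "v \<cdot> p \<in> A"
        using idealD(2)[OF \<open>ideal I\<close>] by (simp add: A_def mult_assoc[symmetric] mult_simps)
      have "x \<cdot> \<lbrace>v, p\<rbrace> = 0" if "x \<in> I" for x
        using leibniz[of x v p] v that idealD(4)[OF \<open>ideal I\<close> that, of p]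
        by (simp add: A_def brk_simps)
      then show "\<lbrace>v, p\<rbrace> \<in> A" using v idealD(4)[OF \<open>ideal I\<close>] by (simp add: A_def)
    qed
    moreover have "\<exists>v\<in>I - {0}. \<forall>x\<in>I. x \<cdot> v = 0"
      using sub \<open>I \<noteq> {0}\<close> nil idealD(2)[OF \<open>ideal I\<close>] by (intro engel_mult) auto
    ultimately have "A = I" by (intro min) (auto simp: A_def)
    then show ?thesis using that by (auto simp: A_def)
  qed
  have brk0: "\<lbrace>x, y\<rbrace> = 0" if "x \<in> I" "y \<in> I" for x y
  proof -
    define A where "A = {v \<in> I. \<forall>x\<in>I. \<lbrace>x, v\<rbrace> = 0}"
    have "ideal A"
    proof (rule idealI)
      show "subspace A"
        using sub by (intro subspaceI) (auto simp: A_def brk_simps subspace_0 subspace_add subspace_scale)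
      fix v p assume v: "v \<in> A"
      then show "v \<cdot> p \<in> A"
        using idealD(2,4)[OF \<open>ideal I\<close>] mult0 by (simp add: A_def brk_mult_right mult_simps)
      have "\<lbrace>x, \<lbrace>v, p\<rbrace>\<rbrace> = 0" if "x \<in> I" for x
        using brk_brk[of x v p] brk_skew[of v "\<lbrace>x, p\<rbrace>"] v that idealD(4)[OF \<open>ideal I\<close> that, of p]
        by (simp add: A_def brk_simps)
      then show "\<lbrace>v, p\<rbrace> \<in> A" using v idealD(4)[OF \<open>ideal I\<close>] by (simp add: A_def)
    qed
    moreover have "\<exists>v\<in>I - {0}. \<forall>x\<in>I. \<lbrace>x, v\<rbrace> = 0"
      using sub \<open>I \<noteq> {0}\<close> nil idealD(4)[OF \<open>ideal I\<close>] by (intro engel_brk) auto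
    ultimately have "A = I" by (intro min) (auto simp: A_def)
    then show ?thesis using that by (auto simp: A_def)
  qed
  show False using zero_idealI[OF \<open>ideal I\<close> mult0 brk0] assms(2) by blast
qed

text \<open>A supplement of a minimal ideal \<open>I \<subseteq> J\<close> also supplements \<open>J\<close>. If \<open>I\<close> lies in the zero socle,
  with ideal complement \<open>C\<close> there, then \<open>C + U\<close> is a supplement: it is proper because it meets
  \<open>I\<close> in \<open>0\<close>.\<close>

lemma phi_free_if_zsoc_complemented:
  assumes "subalgebra U" "direct_decomposition zsoc U"
  shows phi_free
  unfolding phi_free_iff_supplemented
proof (intro allI impI, elim conjE)
  fix J assume "ideal J" "J \<noteq> {0}"
  then obtain I where I: "minimal_ideal I" "I \<subseteq> J" by (rule minimal_ideal_exists)
  have "ideal I" "I \<noteq> {0}" using I(1) by (simp_all add: minimal_ideal_def)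
  have U: "zsoc + U = UNIV" "zsoc \<inter> U = {0}" using assms(2) by (simp_all add: direct_decomposition_def)
  have "\<exists>M. subalgebra M \<and> M \<noteq> UNIV \<and> I + M = UNIV"
  proof (cases "zero_ideal I")
    case False
    then show ?thesis by (rule minimal_nonzero_product_ideal_supplement[OF I(1)])
  next
    case True
    have "I \<subseteq> zsoc" by (rule minimal_zero_ideal_subset_zsoc[OF I(1) True])
    then obtain C where C: "ideal C" "I \<inter> C = {0}" "I + C = zsoc"
      by (rule zsoc_ideal_complement[OF \<open>ideal I\<close>])
    have "C + U \<noteq> UNIV"
    proof
      assume all: "C + U = UNIV"
      have "I \<subseteq> {0}"
      proof
        fix x assume x: "x \<in> I"
        have "x \<in> C + U" using all by simp
        then obtain c u where cu: "x = c + u" "c \<in> C" "u \<in> U" by (rule set_plus_elim)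
        have "c \<in> zsoc" using plus_upper(2)[of I C] C \<open>ideal I\<close> cu(2) idealD(1) by auto
        moreover have "u = x - c" using cu(1) by simp
        ultimately have "u \<in> zsoc"
          using x \<open>I \<subseteq> zsoc\<close> by (auto intro!: subspace_diff subspace_zsoc)
        then have "u = 0" using U(2) cu(3) by blast
        then show "x \<in> {0}" using C(2) cu(1,2) x by auto
      qed
      then show False using \<open>I \<noteq> {0}\<close> subspace_0[OF idealD(1)[OF \<open>ideal I\<close>]] by blast
    qed
    moreover have "I + (C + U) = UNIV" using U(1) C(3) by (simp add: add.assoc[symmetric])
    ultimately show ?thesis using subalgebra_ideal_plus[OF C(1) assms(1)] by blast
  qed
  then obtain M where M: "subalgebra M" "M \<noteq> UNIV" "I + M = UNIV" by blast
  moreover have "J + M = UNIV" using set_plus_mono2[OF I(2) order.refl, of M] M(3) by auto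
  ultimately show "\<exists>M. subalgebra M \<and> M \<noteq> UNIV \<and> J + M = UNIV" by blast
qed

section \<open>Characteristic zero\<close>

text \<open>By the Jacobi identity, bracketing with \<open>\<lbrace>x, y\<rbrace>\<close> is the commutator of bracketing with \<open>x\<close> and
  with \<open>y\<close>, and so Jacobson's lemma applies.\<close>

lemma brk_nilpotent_if_commuting:
  assumes "CHAR('k) = 0" "\<lbrace>\<lbrace>x, y\<rbrace>, y\<rbrace> = 0"
  shows "null_component (brk \<lbrace>x, y\<rbrace>) = UNIV"
proof (rule commutator_nilpotent[OF brk_linear_right assms(1) brk_linear_right brk_linear_right])
  show "\<lbrace>x, \<lbrace>y, v\<rbrace>\<rbrace> = \<lbrace>y, \<lbrace>x, v\<rbrace>\<rbrace> + \<lbrace>\<lbrace>x, y\<rbrace>, v\<rbrace>" for v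
    using brk_brk[of x y v] by simp
  show "\<lbrace>\<lbrace>x, y\<rbrace>, \<lbrace>y, v\<rbrace>\<rbrace> = \<lbrace>y, \<lbrace>\<lbrace>x, y\<rbrace>, v\<rbrace>\<rbrace>" for v
    using brk_brk[of "\<lbrace>x, y\<rbrace>" y v] assms(2) by (simp add: brk_simps)
qed

lemma subspace_brk_nilpotent:
  assumes A: "subspace A" "\<And>a b. a \<in> A \<Longrightarrow> b \<in> A \<Longrightarrow> \<lbrace>a, b\<rbrace> = 0"
  shows "subspace {a \<in> A. null_component (brk a) = UNIV}"
proof (rule subspaceI)
  have "v \<in> null_component (brk 0)" for v
    by (auto simp: null_component_def brk_simps intro!: exI[of _ "1::nat"])
  then show "0 \<in> {a \<in> A. null_component (brk a) = UNIV}" using subspace_0[OF A(1)] by auto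
  fix a b c
  assume a: "a \<in> {a \<in> A. null_component (brk a) = UNIV}"
    and b: "b \<in> {a \<in> A. null_component (brk a) = UNIV}"
  have "v \<in> null_component (\<lambda>v. \<lbrace>a, v\<rbrace> + \<lbrace>b, v\<rbrace>)" for v
  proof (rule null_component_add_commuting[OF brk_linear_right brk_linear_right])
    show "\<lbrace>a, \<lbrace>b, w\<rbrace>\<rbrace> = \<lbrace>b, \<lbrace>a, w\<rbrace>\<rbrace>" for w
      using brk_brk[of a b w] A(2) a b by (simp add: brk_simps)
  qed (use a b in auto)
  moreover have "brk (a + b) = (\<lambda>v. \<lbrace>a, v\<rbrace> + \<lbrace>b, v\<rbrace>)" by (simp add: fun_eq_iff brk_simps)
  ultimately show "a + b \<in> {a \<in> A. null_component (brk a) = UNIV}"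
    using a b subspace_add[OF A(1)] by auto
  have "(brk (scale c a) ^^ n) v = scale (c ^ n) ((brk a ^^ n) v)" for n v
    by (induction n) (simp_all add: brk_simps)
  moreover have "\<exists>n. (brk a ^^ n) v = 0" for v using a by (auto simp: null_component_def)
  ultimately have "v \<in> null_component (brk (scale c a))" for v
    unfolding null_component_def by (metis (mono_tags, lifting) mem_Collect_eq scale_zero_right)
  then show "scale c a \<in> {a \<in> A. null_component (brk a) = UNIV}"
    using a subspace_scale[OF A(1)] by auto
qed

text \<open>An abelian ideal \<open>Z\<close> of \<open>U\<close> inside the radical that acts nilpotently is zero. By Engel's
  theorem it annihilates a nonzero vector in every nonzero ideal inside \<open>N\<close>; as the annihilator
  of \<open>Z\<close> in \<open>N\<close> has an ideal as complement, it is all of \<open>N\<close>. Then \<open>N + Z\<close> is a zero ideal and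
  hence part of \<open>N\<close>.\<close>

lemma phi_free_nil_ideal_trivial:
  assumes phi_free and U: "direct_decomposition nilradical U" and Z: "ideal_in U Z" "Z \<subseteq> radical"
    and abel: "\<And>x y. x \<in> Z \<Longrightarrow> y \<in> Z \<Longrightarrow> \<lbrace>x, y\<rbrace> = 0"
    and nil: "\<And>z. z \<in> Z \<Longrightarrow> null_component (brk z) = UNIV"
  shows "Z = {0}"
proof -
  let ?N = nilradical and ?R = radical
  have N: "zero_ideal ?N" by (rule phi_free_nilradical_zero_ideal[OF assms(1)])
  have "ideal ?N" "ideal ?R" by (rule nilradical_greatest radical_greatest)+
  have "?N \<subseteq> ?R" by (intro radical_greatest zero_ideal_solvable N \<open>ideal ?N\<close>)
  have R0: "x \<cdot> y = 0" if "x \<in> ?R" "y \<in> ?R" for x y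
    using mult_spaceI[OF that] phi_free_radical_mult[OF assms(1)] by simp
  have dec: "\<exists>n\<in>?N. \<exists>u\<in>U. p = n + u" for p
  proof -
    have "p \<in> ?N + U" using U by (simp add: direct_decomposition_def)
    then show ?thesis unfolding set_plus_def by blast
  qed
  define T where "T = {v \<in> ?N. \<forall>z\<in>Z. \<lbrace>z, v\<rbrace> = 0}"
  have "ideal T"
  proof (rule idealI)
    show "subspace T"
      using idealD(1)[OF \<open>ideal ?N\<close>]
      by (intro subspaceI) (auto simp: T_def brk_simps subspace_0 subspace_add subspace_scale)
    fix v p assume v: "v \<in> T"
    then have "v \<in> ?N" by (simp add: T_def)
    have zv: "\<lbrace>z, v\<rbrace> = 0" if "z \<in> Z" for z using v that by (simp add: T_def)
    have "\<lbrace>z, v \<cdot> p\<rbrace> = 0" if "z \<in> Z" for z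
    proof -
      have "v \<cdot> \<lbrace>z, p\<rbrace> = 0"
        using \<open>v \<in> ?N\<close> \<open>?N \<subseteq> ?R\<close> Z(2) that idealD(4)[OF \<open>ideal ?R\<close>] by (intro R0) auto
      then show ?thesis by (simp add: brk_mult_right zv[OF that] mult_simps)
    qed
    then show "v \<cdot> p \<in> T" using \<open>v \<in> ?N\<close> idealD(2)[OF \<open>ideal ?N\<close>] by (simp add: T_def)
    have "\<lbrace>z, \<lbrace>v, p\<rbrace>\<rbrace> = 0" if "z \<in> Z" for z
    proof -
      obtain n u where p: "n \<in> ?N" "u \<in> U" "p = n + u" using dec by blast
      have "\<lbrace>v, \<lbrace>z, n\<rbrace>\<rbrace> = 0"
        using zero_idealD(3)[OF N \<open>v \<in> ?N\<close>] idealD(5)[OF \<open>ideal ?N\<close> p(1)] by simp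
      moreover have "\<lbrace>v, \<lbrace>z, u\<rbrace>\<rbrace> = 0"
        using zv[OF ideal_inD(5)[OF Z(1) that p(2)]] brk_skew[of v "\<lbrace>z, u\<rbrace>"] by simp
      ultimately show ?thesis using brk_brk[of z v p] zv[OF that] by (simp add: p(3) brk_simps)
    qed
    then show "\<lbrace>v, p\<rbrace> \<in> T" using \<open>v \<in> ?N\<close> idealD(4)[OF \<open>ideal ?N\<close>] by (simp add: T_def)
  qed
  moreover have "T \<subseteq> ?N" by (auto simp: T_def)
  ultimately obtain C where C: "ideal C" "C \<subseteq> ?N" "T \<inter> C = {0}" "T + C = ?N"
    by (rule phi_free_ideal_complement[OF assms(1) N])
  have "C = {0}"
  proof (rule ccontr)
    assume "C \<noteq> {0}"
    then have "\<exists>v\<in>C - {0}. \<forall>z\<in>Z. \<lbrace>z, v\<rbrace> = 0"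
      using ideal_inD(1)[OF Z(1)] abel subspace_0[OF ideal_inD(1)[OF Z(1)]] idealD(1,5)[OF C(1)] nil
      by (intro engel_brk) auto
    then have "\<exists>v\<in>C - {0}. v \<in> T \<inter> C" using C(2) by (auto simp: T_def)
    then show False using C(3) by blast
  qed
  then have "T = ?N" using C(4) by simp
  then have ZN: "\<lbrace>z, n\<rbrace> = 0" "\<lbrace>n, z\<rbrace> = 0" if "z \<in> Z" "n \<in> ?N" for z n
    using that brk_skew[of n z] by (auto simp: T_def)
  have up: "?N \<subseteq> ?N + Z" "Z \<subseteq> ?N + Z"
    using plus_upper[OF idealD(1)[OF \<open>ideal ?N\<close>] ideal_inD(1)[OF Z(1)]] by auto
  have "zero_ideal (?N + Z)"
  proof (rule zero_idealI)
    show "ideal (?N + Z)"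
    proof (rule idealI)
      show "subspace (?N + Z)" by (intro subspace_plus idealD(1)[OF \<open>ideal ?N\<close>] ideal_inD(1)[OF Z(1)])
      fix x p assume "x \<in> ?N + Z"
      then obtain n z where x: "x = n + z" "n \<in> ?N" "z \<in> Z" by (rule set_plus_elim)
      obtain n' u where p: "n' \<in> ?N" "u \<in> U" "p = n' + u" using dec by blast
      have "x \<cdot> p = (n \<cdot> p + z \<cdot> n') + z \<cdot> u" "\<lbrace>x, p\<rbrace> = (\<lbrace>n, p\<rbrace> + \<lbrace>z, n'\<rbrace>) + \<lbrace>z, u\<rbrace>"
        by (simp_all add: x(1) p(3) mult_simps brk_simps)
      moreover have "n \<cdot> p + z \<cdot> n' \<in> ?N" "\<lbrace>n, p\<rbrace> + \<lbrace>z, n'\<rbrace> \<in> ?N"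
        using x(2) p(1) \<open>ideal ?N\<close> by (simp_all add: subspace_add idealD)
      moreover have "z \<cdot> u \<in> Z" "\<lbrace>z, u\<rbrace> \<in> Z" using ideal_inD(3,5)[OF Z(1) x(3) p(2)] by simp_all
      ultimately show "x \<cdot> p \<in> ?N + Z" "\<lbrace>x, p\<rbrace> \<in> ?N + Z" by (simp_all add: set_plus_intro)
    qed
    fix x y assume "x \<in> ?N + Z" "y \<in> ?N + Z"
    then obtain n z n' z' where *: "x = n + z" "n \<in> ?N" "z \<in> Z" "y = n' + z'" "n' \<in> ?N" "z' \<in> Z"
      by (auto elim!: set_plus_elim)
    show "x \<cdot> y = 0"
      using * \<open>?N \<subseteq> ?R\<close> Z(2) by (intro R0) (auto intro!: subspace_add idealD(1)[OF \<open>ideal ?R\<close>])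
    show "\<lbrace>x, y\<rbrace> = 0"
      using * by (simp add: brk_simps ZN abel zero_idealD(3)[OF N])
  qed
  then have "?N + Z \<subseteq> ?N" by (intro nilradical_greatest zero_ideal_nilpotent zero_idealD(1))
  then have "Z \<subseteq> ?N \<inter> U" using up(2) ideal_inD(2)[OF Z(1)] by blast
  then show ?thesis
    using U subspace_0[OF ideal_inD(1)[OF Z(1)]] by (auto simp: direct_decomposition_def)
qed

text \<open>If the square \<open>A\<close> of \<open>C\<close> is abelian, then \<open>\<lbrace>c, a\<rbrace>\<close> commutes with \<open>a\<close> for \<open>a \<in> A\<close>, and so the
  elements of \<open>\<lbrace>C, A\<rbrace>\<close> act nilpotently. Hence \<open>\<lbrace>C, A\<rbrace> = 0\<close>, so that now every commutator in \<open>A\<close>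
  commutes with its two factors, and the same argument gives \<open>A = 0\<close>.\<close>

lemma square_trivial_if_square_abelian:
  assumes "CHAR('k) = 0" phi_free and U: "subalgebra U" "direct_decomposition nilradical U"
    and C: "ideal_in U C" "C \<subseteq> radical" and "square (square C) = {0}"
  shows "square C = {0}"
proof -
  define A where "A = square C"
  have A: "ideal_in U A" unfolding A_def square_eq_alg_product by (rule ideal_in_alg_product[OF C(1) C(1)])
  have "A \<subseteq> radical"
    using alg_product_ideal_subset(1)[OF radical_greatest(1), of radical] alg_product_mono[OF C(2) C(2)]
    by (simp add: A_def square_eq_alg_product)
  have abel: "\<lbrace>a, b\<rbrace> = 0" if "a \<in> A" "b \<in> A" for a b
    using assms(7) that square_eq_0_iff[OF ideal_inD(1)[OF A]] by (simp add: A_def)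
  have R0: "x \<cdot> y = 0" if "x \<in> radical" "y \<in> radical" for x y
    using mult_spaceI[OF that] phi_free_radical_mult[OF assms(2)] by simp
  \<comment> \<open>Used first for \<open>D = A\<close> and then for \<open>D = C\<close>.\<close>
  have trivial: "alg_product C D = {0}" if D: "ideal_in U D" "D \<subseteq> radical" "alg_product C D \<subseteq> A"
      "\<And>c d. c \<in> C \<Longrightarrow> d \<in> D \<Longrightarrow> \<lbrace>\<lbrace>c, d\<rbrace>, d\<rbrace> = 0" for D
  proof (rule phi_free_nil_ideal_trivial[OF assms(2) U(2)])
    let ?Z = "alg_product C D" and ?S = "{a \<in> A. null_component (brk a) = UNIV}"
    show "ideal_in U ?Z" by (rule ideal_in_alg_product[OF C(1) D(1)])
    show "?Z \<subseteq> radical" using D(3) \<open>A \<subseteq> radical\<close> by simp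
    show "\<lbrace>x, y\<rbrace> = 0" if "x \<in> ?Z" "y \<in> ?Z" for x y using abel D(3) that by blast
    have S: "subspace ?S" by (rule subspace_brk_nilpotent[OF ideal_inD(1)[OF A] abel])
    have "?Z \<subseteq> ?S"
    proof (subst alg_product_subset_iff[OF S], intro ballI)
      fix c d assume cd: "c \<in> C" "d \<in> D"
      have "c \<cdot> d = 0" using cd C(2) D(2) by (intro R0) auto
      moreover have "\<lbrace>c, d\<rbrace> \<in> ?S"
        using alg_productI(2)[OF cd] D(3) brk_nilpotent_if_commuting[OF assms(1) D(4)[OF cd]] by auto
      ultimately show "c \<cdot> d \<in> ?S \<and> \<lbrace>c, d\<rbrace> \<in> ?S" using subspace_0[OF S] by simp
    qed
    then show "null_component (brk z) = UNIV" if "z \<in> ?Z" for z using that by blast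
  qed
  have CA: "alg_product C A \<subseteq> A"
    using ideal_inD(4,6)[OF A] ideal_inD(2)[OF C(1)]
    by (subst alg_product_subset_iff[OF ideal_inD(1)[OF A]]) auto
  have "alg_product C A = {0}"
    using CA abel alg_productI(2)[of _ C _ A] by (intro trivial A \<open>A \<subseteq> radical\<close>) blast+
  then have central: "\<lbrace>c, a\<rbrace> = 0" if "c \<in> C" "a \<in> A" for c a
    using alg_productI(2)[OF that] by simp
  have "alg_product C C = {0}"
  proof (rule trivial[OF C])
    show "alg_product C C \<subseteq> A" by (simp add: A_def square_eq_alg_product)
    show "\<lbrace>\<lbrace>c, d\<rbrace>, d\<rbrace> = 0" if "c \<in> C" "d \<in> C" for c d
      using central[OF that(2), of "\<lbrace>c, d\<rbrace>"] alg_productI(2)[OF that] brk_skew[of "\<lbrace>c, d\<rbrace>" d]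
      by (simp add: A_def square_eq_alg_product)
  qed
  then show ?thesis by (simp add: square_eq_alg_product)
qed

text \<open>The derived series of \<open>U \<inter> R\<close> reaches zero, and this descends to its first derived term one step
  at a time: a zero term two steps after \<open>C\<close> forces a zero term right after \<open>C\<close>.\<close>

lemma complement_meets_radical_in_zero_algebra:
  assumes "CHAR('k) = 0" phi_free and U: "subalgebra U" "direct_decomposition nilradical U"
  shows "square (U \<inter> radical) = {0}"
proof -
  let ?B = "U \<inter> radical"
  have B: "ideal_in U ?B"
    using U(1) radical_greatest(1) idealD[OF radical_greatest(1)]
    by (auto simp: ideal_in_def subalgebra_def subspace_inter)
  have D: "ideal_in U (derived ?B n)" for n
    by (induction n) (simp_all add: B square_eq_alg_product ideal_in_alg_product)
  have D_R: "derived ?B n \<subseteq> radical" for n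
  proof -
    have "derived radical n \<subseteq> radical"
      by (induction n)
         (auto simp: square_eq_alg_product
           intro: subsetD[OF alg_product_ideal_subset(1)[OF radical_greatest(1)]]
             subsetD[OF alg_product_mono])
    then show ?thesis using derived_mono[of ?B radical n] by auto
  qed
  obtain m where m: "derived radical m = {0}" using radical_greatest(2) by (auto simp: solvable_def)
  then have "derived ?B m \<subseteq> {0}" using derived_mono[of ?B radical m] by auto
  then have "derived ?B m = {0}" using subspace_0[OF ideal_inD(1)[OF D]] by blast
  then have "derived ?B (Suc m) = {0}"
    by (simp add: square_eq_0_iff mult_simps brk_simps)
  moreover have "derived ?B (Suc n) = {0} \<Longrightarrow> square ?B = {0}" for n
  proof (induction n)
    case (Suc n)
    then have "square (derived ?B n) = {0}"
      by (intro square_trivial_if_square_abelian[OF assms D D_R]) simp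
    then show ?case using Suc.IH by simp
  qed simp
  ultimately show ?thesis by blast
qed

end

theorem theorem4p5:
  fixes scale :: "'k::field \<Rightarrow> 'p::ab_group_add \<Rightarrow> 'p"
    and mult brk :: "'p \<Rightarrow> 'p \<Rightarrow> 'p"
    and Basis R N :: "'p set"
  assumes "poisson_algebra scale mult brk"
    and "finite_dimensional_vector_space scale Basis"
    and "R = poisson_algebra.radical scale mult brk"
    and "N = poisson_algebra.nilradical scale mult brk"
  shows
    "(poisson_algebra.phi_free scale mult brk \<longleftrightarrow>
        (\<exists>U. poisson_algebra.subalgebra scale mult brk U \<and>
             direct_decomposition N U) \<and>
        N = poisson_algebra.zsoc scale mult brk \<and>
        poisson_algebra.mult_space scale mult R R = {0}) \<and>
     (CHAR('k) = 0 \<and> poisson_algebra.phi_free scale mult brk \<longrightarrow>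
        (\<forall>U. poisson_algebra.subalgebra scale mult brk U \<and>
             direct_decomposition N U \<longrightarrow>
             poisson_algebra.square scale mult brk (U \<inter> R) = {0}))"
proof -
  interpret fin_dim_poisson_algebra scale mult brk Basis
    using assms(1,2) by (simp add: fin_dim_poisson_algebra_def)
  have [simp]: "R = radical" "N = nilradical" by (fact assms)+
  show ?thesis
  proof (intro conjI impI iffI)
    assume phi_free
    show "\<exists>U. subalgebra U \<and> direct_decomposition N U"
      using phi_free_zero_ideal_complement[OF \<open>phi_free\<close> phi_free_nilradical_zero_ideal[OF \<open>phi_free\<close>]]
      by auto
    show "N = zsoc" "mult_space R R = {0}"
      using \<open>phi_free\<close> by (simp_all add: phi_free_nilradical_eq_zsoc phi_free_radical_mult)
  next
    assume "(\<exists>U. subalgebra U \<and> direct_decomposition N U) \<and> N = zsoc \<and> mult_space R R = {0}"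
    then show phi_free using phi_free_if_zsoc_complemented by auto
  next
    assume "CHAR('k) = 0 \<and> phi_free"
    then show "\<forall>U. subalgebra U \<and> direct_decomposition N U \<longrightarrow> square (U \<inter> R) = {0}"
      using complement_meets_radical_in_zero_algebra by simp
  qed
qed

end
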